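(* Let $\Pi=\mathbb{R}/\mathbb{Z}$ be the circle, let $\sigma,b\in C^2(\Pi)$ with $a:=\sigma^2/2>0$, and assume that $b$ is separated from $0$ on $\Pi$ (i.e. $b(x)\ne0$ for all $x\in\Pi$). Then the functionals $I_\varepsilon$ $\Gamma$-converge to $J$ as $\varepsilon\to0$ with respect to the weak topology on the space $P(\Pi)$ of probability measures on $\Pi$.
   Context: For $\varepsilon>0$ and $\mu\in P(\Pi)$, $$I_\varepsilon(\mu):=\sup_{u\in C^2(\Pi),\,u>0}\;-\int_\Pi\frac{\varepsilon\,a\,u''+b\,u'}{u}\,d\mu .$$ For $c\in C^0(\Pi)$, let $\lambda_\varepsilon^c$ be the principal eigenvalue (the eigenvalue with maximal real part) of the operator $u\mapsto\varepsilon\,a\,u''+b\,u'+c\,u$ on $\Pi$. Let $\Lambda(c):=\lim_{\varepsilon\to0}\lambda_\varepsilon^c$ (this limit exists under the present assumptions), and $$J(\mu):=\sup_{c\in C^0(\Pi)}\Bigl\{\int_\Pi c\,d\mu-\Lambda(c)\Bigr\}.$$ Weak convergence $\mu_\varepsilon\rightharpoonup\mu$ means $\int_\Pi f\,d\mu_\varepsilon\to\int_\Pi f\,d\mu$ for all $f\in C^0(\Pi)$. $\Gamma$-convergence of $I_\varepsilon$ to $J$ means that for every $\mu\in P(\Pi)$: (i) for every $(\mu_\varepsilon)$ in $P(\Pi)$ with $\mu_\varepsilon\rightharpoonup\mu$, $J(\mu)\le\liminf_{\varepsilon\to0}I_\varepsilon(\mu_\varepsilon)$; and (ii) there exists $(\mu_\varepsilon)$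 in $P(\Pi)$ with $\mu_\varepsilon\rightharpoonup\mu$ and $J(\mu)\ge\limsup_{\varepsilon\to0}I_\varepsilon(\mu_\varepsilon)$ (along any sequence $\varepsilon\to0$). *)

theory Defs
  imports "HOL-Probability.Probability"
begin

text \<open>
  Functions on \<open>\<Pi> = \<real>/\<int>\<close> are represented by 1-periodic functions on \<open>\<real>\<close>. They may be real or
  complex valued, since eigenfunctions have to be allowed to be complex.
\<close>

definition C0_circle :: "(real \<Rightarrow> 'a::real_normed_vector) set" where
  "C0_circle = {f. (\<forall>x. f (x + 1) = f x) \<and> continuous_on UNIV f}"

definition D :: "(real \<Rightarrow> 'a::real_normed_vector) \<Rightarrow> real \<Rightarrow> 'a" where
  "D f x = vector_derivative f (at x)"

definition C2_circle :: "(real \<Rightarrow> 'a::real_normed_vector) set" where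
  "C2_circle = {f. (\<forall>x. f (x + 1) = f x) \<and>
     (\<forall>x. f differentiable (at x)) \<and>
     (\<forall>x. D f differentiable (at x)) \<and>
     continuous_on UNIV (D (D f))}"

text \<open>
  The projection \<open>[0,1) \<rightarrow> \<real>/\<int>\<close> is a Borel isomorphism, so Borel probability measures on the
  circle are Borel probability measures on \<open>[0,1)\<close>. The topology of the circle enters only through
  the test functions in the weak convergence, which are periodic: mass approaching \<open>1\<close> from
  the left converges to mass at \<open>0\<close>.
\<close>

definition P_circle :: "real measure set" where
  "P_circle = {\<mu>. prob_space \<mu> \<and> sets \<mu> = sets (restrict_space borel {0..<1})}"

definition weakly_converges :: "('i \<Rightarrow> real measure) \<Rightarrow> real measure \<Rightarrow> 'i filter \<Rightarrow> bool" where
  "weakly_converges m \<mu> F \<longleftrightarrow>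
     (\<forall>f :: real \<Rightarrow> real. f \<in> C0_circle \<longrightarrow>
        ((\<lambda>i. \<integral>x. f x \<partial>(m i)) \<longlongrightarrow> (\<integral>x. f x \<partial>\<mu>)) F)"

definition gen ::
  "(real \<Rightarrow> real) \<Rightarrow> (real \<Rightarrow> real) \<Rightarrow> real \<Rightarrow> (real \<Rightarrow> 'a::real_normed_vector) \<Rightarrow> real \<Rightarrow> 'a" where
  "gen a b \<epsilon> u x = (\<epsilon> * a x) *\<^sub>R D (D u) x + b x *\<^sub>R D u x"

definition I_fun :: "(real \<Rightarrow> real) \<Rightarrow> (real \<Rightarrow> real) \<Rightarrow> real \<Rightarrow> real measure \<Rightarrow> ereal" where
  "I_fun a b \<epsilon> \<mu> =
     (SUP u \<in> {u \<in> C2_circle. \<forall>x. 0 < u x}. ereal (- (\<integral>x. gen a b \<epsilon> u x / u x \<partial>\<mu>)))"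

definition eigenvalue ::
  "(real \<Rightarrow> real) \<Rightarrow> (real \<Rightarrow> real) \<Rightarrow> real \<Rightarrow> (real \<Rightarrow> real) \<Rightarrow> complex \<Rightarrow> bool" where
  "eigenvalue a b \<epsilon> c z \<longleftrightarrow>
     (\<exists>u :: real \<Rightarrow> complex. u \<in> C2_circle \<and> (\<exists>x. u x \<noteq> 0) \<and>
        (\<forall>x. gen a b \<epsilon> u x + c x *\<^sub>R u x = z * u x))"

text \<open>
  The eigenvalues are closed under complex conjugation, so an eigenvalue that is the only one with
  maximal real part is real; taking \<open>Re\<close> below is then merely the passage from \<open>complex\<close> to \<open>real\<close>.
\<close>

definition principal_eigenvalue ::
  "(real \<Rightarrow> real) \<Rightarrow> (real \<Rightarrow> real) \<Rightarrow> real \<Rightarrow> (real \<Rightarrow> real) \<Rightarrow> real" where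
  "principal_eigenvalue a b \<epsilon> c =
     Re (THE z. eigenvalue a b \<epsilon> c z \<and> (\<forall>w. eigenvalue a b \<epsilon> c w \<longrightarrow> Re w \<le> Re z))"

definition Lambda :: "(real \<Rightarrow> real) \<Rightarrow> (real \<Rightarrow> real) \<Rightarrow> (real \<Rightarrow> real) \<Rightarrow> real" where
  "Lambda a b c = Lim (at_right 0) (\<lambda>\<epsilon>. principal_eigenvalue a b \<epsilon> c)"

definition J_fun :: "(real \<Rightarrow> real) \<Rightarrow> (real \<Rightarrow> real) \<Rightarrow> real measure \<Rightarrow> ereal" where
  "J_fun a b \<mu> = (SUP c \<in> C0_circle. ereal ((\<integral>x. c x \<partial>\<mu>) - Lambda a b c))"

definition gamma_converges ::
  "(real \<Rightarrow> real measure \<Rightarrow> ereal) \<Rightarrow> (real measure \<Rightarrow> ereal) \<Rightarrow> bool" where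
  "gamma_converges I J \<longleftrightarrow> (\<forall>\<mu> \<in> P_circle.
     (\<forall>m. (\<forall>\<epsilon>>0. m \<epsilon> \<in> P_circle) \<and> weakly_converges m \<mu> (at_right 0) \<longrightarrow>
        J \<mu> \<le> Liminf (at_right 0) (\<lambda>\<epsilon>. I \<epsilon> (m \<epsilon>))) \<and>
     (\<exists>m. (\<forall>\<epsilon>>0. m \<epsilon> \<in> P_circle) \<and> weakly_converges m \<mu> (at_right 0) \<and>
        J \<mu> \<ge> Limsup (at_right 0) (\<lambda>\<epsilon>. I \<epsilon> (m \<epsilon>))))"

end

theory Submission
  imports Defs
begin

text \<open>
  Let \<open>\<nu>\<close> be the probability measure with density proportional to \<open>1 / b\<close>, which is invariant
  under the flow of \<open>b\<close>. Solving \<open>b f' + c = \<integral> c d\<nu>\<close> for smooth \<open>c\<close> and comparing \<open>exp f\<close> with the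
  positive eigenfunction by the maximum principle gives \<open>\<Lambda>(c) = \<integral> c d\<nu>\<close>, so that \<open>J\<close> is \<open>0\<close> at \<open>\<nu>\<close>
  and infinite elsewhere.

  Lower bound: if \<open>\<integral> c d\<mu> \<noteq> \<integral> c d\<nu>\<close>, then the test functions \<open>exp (t f)\<close> show that the lower limit is
  infinite. Upper bound: the constant sequence works, because with \<open>w = ln u\<close> and \<open>\<rho>\<close> the density
  of \<open>\<nu>\<close> times \<open>a\<close>, integration by parts gives
  \<open>- \<integral> (\<epsilon> a u'' + b u') / u d\<nu> = \<epsilon> \<integral> (\<rho>' w' - \<rho> w'\<^sup>2) dx \<le> \<epsilon> \<integral> \<rho>'\<^sup>2 / (4 \<rho>) dx\<close>.

  The principal eigenvalue is the one with a positive eigenfunction; its existence follows from a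
  study of the monodromy matrix of the eigenvalue equation.
\<close>

section \<open>Calculus on the circle\<close>

text \<open>The limit is explicit because \<open>b\<close> never vanishes:
  \<open>(\<integral> c d\<nu> - c) / b\<close> is then an admissible derivative, and the weight
  \<open>1 / b\<close> in \<nu> is exactly what makes its primitive \<open>f\<close> periodic. This
  \<open>f\<close> is twice differentiable only if \<open>c\<close> is differentiable, so a general
  \<open>c\<close> is first replaced by a uniformly close C1 function; eigenvalue comparison and
  averages both tolerate an error in the supremum norm. With \<open>f\<close> fixed,
  \<open>exp f\<close> is an eigenfunction up to order \<epsilon>, since the second-order term
  carries the factor \<epsilon>. Because \<Lambda> turns out to be linear in \<open>c\<close>, its
  conjugate J can take only the values 0 and infinity. The remaining obstacle is the definite
  description of the principal eigenvalue among complex eigenvalues: its value can be computed only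
  once a positive eigenfunction is known to exist and every other eigenvalue is known to have
  strictly smaller real part.\<close>

lemma C2_circleI:
  fixes f :: "real \<Rightarrow> 'a::real_normed_vector"
  assumes per: "\<And>x. f (x + 1) = f x"
    and f: "\<And>x. (f has_vector_derivative f' x) (at x)"
    and f': "\<And>x. (f' has_vector_derivative f'' x) (at x)"
    and cont: "continuous_on UNIV f''"
  shows "f \<in> C2_circle" "D f = f'" "D (D f) = f''"
proof -
  show 1: "D f = f'"
    unfolding D_def using f by (auto simp: vector_derivative_at)
  show 2: "D (D f) = f''"
    unfolding 1 unfolding D_def using f' by (auto simp: vector_derivative_at)
  show "f \<in> C2_circle"
    using per f f' cont 1 2 unfolding C2_circle_def mem_Collect_eq
    by (metis differentiableI_vector)
qed

lemma
  fixes f :: "real \<Rightarrow> 'a::real_normed_vector"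
  assumes "f \<in> C2_circle"
  shows C2_circle_periodic: "f (x + 1) = f x"
    and C2_circle_D: "(f has_vector_derivative D f x) (at x)"
    and C2_circle_DD: "(D f has_vector_derivative D (D f) x) (at x)"
    and C2_circle_C0: "f \<in> C0_circle"
    and C2_circle_D_C0: "D f \<in> C0_circle"
    and C2_circle_DD_C0: "D (D f) \<in> C0_circle"
proof -
  have per: "f (x + 1) = f x" for x
    using assms by (simp add: C2_circle_def)
  have f: "(f has_vector_derivative D f x) (at x)" for x
    using assms unfolding C2_circle_def D_def
    by (auto simp: vector_derivative_works)
  have f': "(D f has_vector_derivative D (D f) x) (at x)" for x
    using assms unfolding C2_circle_def D_def[of "D f"]
    by (auto simp: vector_derivative_works)
  \<comment> \<open>A periodic function equals its translate, so uniqueness of derivatives makes the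
    derivative periodic as well.\<close>
  have shift: "(g has_vector_derivative g' (x + 1)) (at x)"
    if "\<And>x. g (x + 1) = g x" "\<And>x. (g has_vector_derivative g' x) (at x)"
    for g g' :: "real \<Rightarrow> 'a" and x
  proof -
    have "((g \<circ> (\<lambda>x. x + 1)) has_vector_derivative 1 *\<^sub>R g' (x + 1)) (at x)"
      by (rule vector_diff_chain_at) (use that in \<open>auto intro!: derivative_eq_intros\<close>)
    thus ?thesis using that(1) by (simp add: o_def)
  qed
  have per': "D f (x + 1) = D f x" for x
    using shift[OF per f] f by (rule vector_derivative_unique_at)
  have per'': "D (D f) (x + 1) = D (D f) x" for x
    using shift[OF per' f'] f' by (rule vector_derivative_unique_at)
  show "f (x + 1) = f x" "(f has_vector_derivative D f x) (at x)"
    "(D f has_vector_derivative D (D f) x) (at x)"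
    by fact+
  show "f \<in> C0_circle" "D f \<in> C0_circle" "D (D f) \<in> C0_circle"
    using assms per per' per'' f f' unfolding C0_circle_def C2_circle_def
    by (auto intro!: continuous_at_imp_continuous_on has_vector_derivative_continuous)
qed

lemma C2_circle_DERIV:
  fixes f :: "real \<Rightarrow> real"
  assumes "f \<in> C2_circle"
  shows "(f has_real_derivative D f x) (at x)" "(D f has_real_derivative D (D f) x) (at x)"
  using C2_circle_D[OF assms] C2_circle_DD[OF assms]
  by (simp_all add: has_real_derivative_iff_has_vector_derivative)

lemma C2_circle_real_I:
  fixes f :: "real \<Rightarrow> real"
  assumes "\<And>x. f (x + 1) = f x"
    and "\<And>x. (f has_real_derivative f' x) (at x)"
    and "\<And>x. (f' has_real_derivative f'' x) (at x)"
    and "continuous_on UNIV f''"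
  shows "f \<in> C2_circle" "D f = f'" "D (D f) = f''"
  using C2_circleI[of f f' f''] assms
  by (simp_all add: has_real_derivative_iff_has_vector_derivative)

lemma periodic_of_int:
  assumes "\<And>x::real. f (x + 1) = f x"
  shows "f (x + of_int n) = f x"
proof -
  have nat: "f (x + real m) = f x" for x m
  proof (induction m)
    case (Suc m)
    have "f (x + real (Suc m)) = f ((x + real m) + 1)" by (simp add: algebra_simps)
    thus ?case using assms Suc by simp
  qed simp
  show ?thesis
  proof (cases "n \<ge> 0")
    case True
    then obtain m where "n = int m" using nonneg_int_cases by blast
    thus ?thesis using nat by simp
  next
    case False
    then obtain m where "n = - int m" using nonpos_int_cases by (metis linear)
    thus ?thesis using nat[of "x - real m" m] by simp
  qed
qed

lemma periodic_frac:
  assumes "\<And>x::real. f (x + 1) = f x"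
  shows "f (frac x) = f x"
  using periodic_of_int[of f "frac x" "\<lfloor>x\<rfloor>", OF assms] by (simp add: frac_def)

lemma frac_in: "frac (x::real) \<in> {0..1}" "frac x \<in> {0..<1}"
  using frac_lt_1[of x] by auto

lemma C0_circle_attains_max:
  fixes f :: "real \<Rightarrow> real"
  assumes "f \<in> C0_circle"
  obtains x where "\<And>y. f y \<le> f x"
proof -
  have per: "\<And>x. f (x + 1) = f x" and cont: "continuous_on {0..1} f"
    using assms by (auto simp: C0_circle_def intro: continuous_on_subset)
  obtain x where "x \<in> {0..1}" "\<And>y. y \<in> {0..1} \<Longrightarrow> f y \<le> f x"
    using continuous_attains_sup[OF _ _ cont] by auto
  thus ?thesis using that periodic_frac[of f, OF per] frac_in by metis
qed

lemma C0_circle_bounded: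
  assumes "f \<in> C0_circle"
  obtains B where "B > 0" "\<And>x. norm (f x) \<le> B"
proof -
  have "(\<lambda>x. norm (f x)) \<in> C0_circle"
    using assms by (auto simp: C0_circle_def intro: continuous_on_norm)
  then obtain x where "\<And>y. norm (f y) \<le> norm (f x)"
    using C0_circle_attains_max by blast
  hence "\<And>y. norm (f y) \<le> norm (f x) + 1"
    by (meson add_increasing2 zero_le_one)
  thus ?thesis using that[of "norm (f x) + 1"] by (simp add: add_nonneg_pos)
qed

section \<open>Primitives and mollification of continuous functions\<close>

lemma continuous_antiderivative:
  fixes f :: "real \<Rightarrow> 'a::banach"
  assumes "continuous_on UNIV f"
  obtains F where "\<And>x. (F has_vector_derivative f x) (at x)"
proof -
  define F where "F x = (if x \<ge> 0 then integral {0..x} f else - integral {x..0} f)" for x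
  have "(F has_vector_derivative f x) (at x)" for x
  proof -
    \<comment> \<open>A window with 0 and \<open>x\<close> in its interior: on it \<open>F\<close>
      differs from the integral starting at \<open>l\<close> by a constant, so the fundamental
      theorem on one interval yields a two-sided derivative at \<open>x\<close>.\<close>
    define l where "l = - \<bar>x\<bar> - 1"
    define r where "r = \<bar>x\<bar> + 1"
    have int: "f integrable_on {u..v}" for u v
      by (intro integrable_continuous_real continuous_on_subset[OF assms]) auto
    have F_eq: "F y = integral {l..y} f - integral {l..0} f" if "y \<in> {l..r}" for y
    proof (cases "y \<ge> 0")
      case True
      have "integral {l..0} f + integral {0..y} f = integral {l..y} f"
        using True by (intro Henstock_Kurzweil_Integration.integral_combine int) (auto simp: l_def)
      thus ?thesis using True by (simp add: F_def algebra_simps)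
    next
      case False
      have "integral {l..y} f + integral {y..0} f = integral {l..0} f"
        using False that by (intro Henstock_Kurzweil_Integration.integral_combine int) auto
      thus ?thesis using False by (simp add: F_def algebra_simps)
    qed
    have x: "x \<in> {l<..<r}" by (auto simp: l_def r_def)
    have "((\<lambda>y. integral {l..y} f) has_vector_derivative f x) (at x within {l..r})"
      using x by (intro integral_has_vector_derivative continuous_on_subset[OF assms]) auto
    hence "((\<lambda>y. integral {l..y} f) has_vector_derivative f x) (at x)"
      using x at_within_interior[of x "{l..r}"] by simp
    hence "((\<lambda>y. integral {l..y} f - integral {l..0} f) has_vector_derivative f x - 0) (at x)"
      by (intro has_vector_derivative_diff) auto
    hence "((\<lambda>y. integral {l..y} f - integral {l..0} f) has_vector_derivative f x) (at x)"
      by simp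
    thus ?thesis
      by (rule has_vector_derivative_transform_within_open[of _ _ _ "{l<..<r}"])
         (use x F_eq in auto)
  qed
  thus ?thesis using that by blast
qed

lemma continuous_antiderivative_real:
  fixes f :: "real \<Rightarrow> real"
  assumes "continuous_on UNIV f"
  obtains F where "\<And>x. (F has_real_derivative f x) (at x)"
  using continuous_antiderivative[OF assms]
  by (metis has_real_derivative_iff_has_vector_derivative)

lemma has_integral_DERIV:
  fixes f :: "real \<Rightarrow> real"
  assumes "\<And>x. (F has_real_derivative f x) (at x)" "u \<le> v"
  shows "(f has_integral F v - F u) {u..v}"
  using assms(2)
  by (rule fundamental_theorem_of_calculus)
     (meson assms(1) has_field_derivative_at_within has_real_derivative_iff_has_vector_derivative)

text \<open>The approximation is the average of \<open>c\<close> over a sliding window of length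
  \<open>h\<close>: its derivative is a difference quotient of \<open>c\<close>, and by the mean
  value theorem its values are values of \<open>c\<close> at nearby points. One derivative is what
  \<open>b f' + c = const\<close> requires for a C2 solution.\<close>

lemma C0_circle_mollify:
  fixes c :: "real \<Rightarrow> real"
  assumes c: "c \<in> C0_circle" and "\<delta> > 0"
  obtains c1 c1' where "c1 \<in> C0_circle" "c1' \<in> C0_circle"
    "\<And>x. (c1 has_real_derivative c1' x) (at x)" "\<And>x. \<bar>c1 x - c x\<bar> \<le> \<delta>"
proof -
  have per: "\<And>x. c (x + 1) = c x" and cont: "continuous_on UNIV c"
    using c by (auto simp: C0_circle_def)
  \<comment> \<open>The interval reaches up to 2 because \<open>frac x\<close> shifted by at most
    \<open>h \<le> 1\<close> may leave the unit interval.\<close>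
  have "uniformly_continuous_on {0..2} c"
    by (intro compact_uniformly_continuous continuous_on_subset[OF cont]) auto
  then obtain e where e: "e > 0"
    "\<And>x y. x \<in> {0..2} \<Longrightarrow> y \<in> {0..2} \<Longrightarrow> dist y x < e \<Longrightarrow> dist (c y) (c x) < \<delta>"
    using \<open>\<delta> > 0\<close> unfolding uniformly_continuous_on_def by metis
  define h where "h = min (e/2) 1"
  have h: "0 < h" "h < e" "h \<le> 1" using e(1) by (auto simp: h_def)
  obtain C where C: "\<And>x. (C has_real_derivative c x) (at x)"
    using continuous_antiderivative_real[OF cont] by blast
  have close: "\<bar>c y - c x\<bar> \<le> \<delta>" if "x \<le> y" "y \<le> x + h" for x y
  proof -
    have "dist (c (frac x + (y - x))) (c (frac x)) < \<delta>"
      using that h frac_in(2)[of x] by (intro e(2)) (auto simp: dist_real_def)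
    moreover have "c (frac x + (y - x)) = c y"
      using periodic_of_int[of c "frac x + (y - x)" "\<lfloor>x\<rfloor>", OF per] by (simp add: frac_def)
    ultimately show ?thesis by (simp add: dist_real_def periodic_frac[of c, OF per])
  qed
  define c1 where "c1 x = (C (x + h) - C x) / h" for x
  define c1' where "c1' x = (c (x + h) - c x) / h" for x
  have shift: "((\<lambda>x. C (x + r)) has_real_derivative c (x + r)) (at x)" for x r
    using C[of "x + r"] by (simp add: DERIV_shift)
  \<comment> \<open>\<open>C\<close> need not be periodic, but its increment over a period is
    constant and hence cancels in \<open>C (x + h) - C x\<close>.\<close>
  have "((\<lambda>x. C (x + 1) - C x) has_real_derivative 0) (at x)" for x
    using DERIV_diff[OF shift[of 1 x] C[of x]] per by simp
  hence const: "C (x + 1) - C x = C (y + 1) - C y" for x y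
    using DERIV_const_ratio_const[of x y "\<lambda>x. C (x + 1) - C x" 0] by (cases "x = y") auto
  have deriv: "(c1 has_real_derivative c1' x) (at x)" for x
    unfolding c1_def c1'_def by (intro DERIV_cdivide DERIV_diff C shift)
  have "c1 (x + 1) = c1 x" for x
    unfolding c1_def using const[of "x + h" x] by (simp add: algebra_simps)
  hence "c1 \<in> C0_circle"
    using deriv by (auto simp: C0_circle_def intro!: continuous_at_imp_continuous_on DERIV_isCont)
  moreover have "c1' \<in> C0_circle"
  proof -
    have "continuous_on UNIV (\<lambda>x. c (x + h))"
      by (intro continuous_on_compose2[OF cont] continuous_intros) auto
    moreover have "c (x + 1 + h) = c (x + h)" for x
      using per[of "x + h"] by (simp add: add_ac)
    ultimately show ?thesis
      using per cont h unfolding C0_circle_def c1'_def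
      by (auto intro!: continuous_intros)
  qed
  moreover have "\<bar>c1 x - c x\<bar> \<le> \<delta>" for x
  proof -
    obtain z where z: "x < z" "z < x + h" "C (x + h) - C x = (x + h - x) * c z"
      using MVT2[of x "x + h" C c] C h by auto
    hence "c1 x = c z" using h by (simp add: c1_def)
    thus ?thesis using close[of x z] z by simp
  qed
  ultimately show ?thesis using that deriv by blast
qed

text \<open>If \<open>f''\<close> were positive, then \<open>f'\<close>, which vanishes at
  \<open>x\<close>, would be positive just to the right of it, and the mean value theorem would
  produce a value of \<open>f\<close> above the maximum.\<close>

lemma DERIV_second_nonpos_at_max:
  fixes f :: "real \<Rightarrow> real"
  assumes f: "\<And>x. (f has_real_derivative f' x) (at x)"
    and f': "(f' has_real_derivative f'') (at x)"
    and max: "\<And>y. f y \<le> f x"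
  shows "f' x = 0" "f'' \<le> 0"
proof -
  show 0: "f' x = 0"
    using DERIV_local_max[OF f[of x], of 1] max by auto
  show "f'' \<le> 0"
  proof (rule ccontr)
    assume "\<not> f'' \<le> 0"
    then obtain d where d: "d > 0" "\<And>h. 0 < h \<Longrightarrow> h < d \<Longrightarrow> f' x < f' (x + h)"
      using has_real_derivative_pos_inc_right[OF f'] by auto
    obtain z where z: "x < z" "z < x + d/2" "f (x + d/2) - f x = (x + d/2 - x) * f' z"
      using MVT2[of x "x + d/2" f f'] f d by auto
    have "f' z > 0" using d(2)[of "z - x"] z d(1) 0 by simp
    hence "(x + d/2 - x) * f' z > 0" using d(1) by simp
    hence "f (x + d/2) > f x" using z(3) by linarith
    thus False using max[of "x + d/2"] by simp
  qed
qed

section \<open>Products, compositions and logarithms of periodic C2 functions\<close>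

lemma C2_circle_mult:
  fixes u v :: "real \<Rightarrow> real"
  assumes u: "u \<in> C2_circle" and v: "v \<in> C2_circle"
  shows "(\<lambda>x. u x * v x) \<in> C2_circle"
    and "D (\<lambda>x. u x * v x) = (\<lambda>x. D u x * v x + u x * D v x)"
    and "D (D (\<lambda>x. u x * v x)) = (\<lambda>x. D (D u) x * v x + 2 * D u x * D v x + u x * D (D v) x)"
proof -
  note d = C2_circle_DERIV[OF u] C2_circle_DERIV[OF v]
  have 1: "u (x + 1) * v (x + 1) = u x * v x" for x
    using C2_circle_periodic[OF u] C2_circle_periodic[OF v] by simp
  have 2: "((\<lambda>x. u x * v x) has_real_derivative D u x * v x + u x * D v x) (at x)" for x
    by (auto intro!: derivative_eq_intros d)
  have 3: "((\<lambda>x. D u x * v x + u x * D v x) has_real_derivative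
      D (D u) x * v x + 2 * D u x * D v x + u x * D (D v) x) (at x)" for x
    by (auto intro!: derivative_eq_intros d)
  have 4: "continuous_on UNIV (\<lambda>x. D (D u) x * v x + 2 * D u x * D v x + u x * D (D v) x)"
    using C2_circle_C0[OF u] C2_circle_D_C0[OF u] C2_circle_DD_C0[OF u]
      C2_circle_C0[OF v] C2_circle_D_C0[OF v] C2_circle_DD_C0[OF v]
    by (auto simp: C0_circle_def intro!: continuous_intros)
  show "(\<lambda>x. u x * v x) \<in> C2_circle"
    "D (\<lambda>x. u x * v x) = (\<lambda>x. D u x * v x + u x * D v x)"
    "D (D (\<lambda>x. u x * v x)) = (\<lambda>x. D (D u) x * v x + 2 * D u x * D v x + u x * D (D v) x)"
    using C2_circle_real_I[OF 1 2 3 4] .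
qed

text \<open>The outer function is constrained only on the range of \<open>u\<close>, so that
  \<open>ln\<close> and \<open>inverse\<close> fit.\<close>

lemma C2_circle_compose:
  fixes u :: "real \<Rightarrow> real"
  assumes u: "u \<in> C2_circle"
    and g: "\<And>x. (g has_real_derivative g' (u x)) (at (u x))"
    and g': "\<And>x. (g' has_real_derivative g'' (u x)) (at (u x))"
    and cont: "continuous_on (range u) g''"
  shows "(\<lambda>x. g (u x)) \<in> C2_circle"
    and "D (\<lambda>x. g (u x)) = (\<lambda>x. g' (u x) * D u x)"
    and "D (D (\<lambda>x. g (u x))) = (\<lambda>x. g'' (u x) * (D u x)\<^sup>2 + g' (u x) * D (D u) x)"
proof -
  note d = C2_circle_DERIV[OF u]
  have 1: "g (u (x + 1)) = g (u x)" for x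
    using C2_circle_periodic[OF u] by simp
  have 2: "((\<lambda>x. g (u x)) has_real_derivative g' (u x) * D u x) (at x)" for x
    using DERIV_chain2[OF g d(1)] .
  have 3: "((\<lambda>x. g' (u x) * D u x) has_real_derivative
      g'' (u x) * (D u x)\<^sup>2 + g' (u x) * D (D u) x) (at x)" for x
    using DERIV_mult[OF DERIV_chain2[OF g' d(1)] d(2)] by (simp add: power2_eq_square algebra_simps)
  have u': "continuous_on UNIV u" "continuous_on UNIV (D u)" "continuous_on UNIV (D (D u))"
    using C2_circle_C0[OF u] C2_circle_D_C0[OF u] C2_circle_DD_C0[OF u]
    by (auto simp: C0_circle_def)
  have "continuous_on UNIV (\<lambda>x. g' (u x))"
    using DERIV_chain2[OF g' d(1)] by (meson DERIV_isCont continuous_at_imp_continuous_on)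
  moreover have "continuous_on UNIV (\<lambda>x. g'' (u x))"
    using continuous_on_compose2[OF cont u'(1)] by simp
  ultimately have 4: "continuous_on UNIV (\<lambda>x. g'' (u x) * (D u x)\<^sup>2 + g' (u x) * D (D u) x)"
    using u' by (intro continuous_intros)
  show "(\<lambda>x. g (u x)) \<in> C2_circle"
    "D (\<lambda>x. g (u x)) = (\<lambda>x. g' (u x) * D u x)"
    "D (D (\<lambda>x. g (u x))) = (\<lambda>x. g'' (u x) * (D u x)\<^sup>2 + g' (u x) * D (D u) x)"
    using C2_circle_real_I[OF 1 2 3 4] .
qed

lemma C2_circle_exp:
  fixes f :: "real \<Rightarrow> real"
  assumes "f \<in> C2_circle"
  shows "(\<lambda>x. exp (f x)) \<in> C2_circle"
    and "D (\<lambda>x. exp (f x)) = (\<lambda>x. exp (f x) * D f x)"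
    and "D (D (\<lambda>x. exp (f x))) = (\<lambda>x. exp (f x) * (D f x)\<^sup>2 + exp (f x) * D (D f) x)"
  by (rule C2_circle_compose[OF assms, where g = exp and g' = exp and g'' = exp];
      auto intro!: continuous_intros)+

lemma C2_circle_inverse:
  fixes u :: "real \<Rightarrow> real"
  assumes "u \<in> C2_circle" "\<And>x. u x \<noteq> 0"
  shows "(\<lambda>x. inverse (u x)) \<in> C2_circle"
  by (rule C2_circle_compose(1)[OF assms(1), where g = inverse and g' = "\<lambda>x. - inverse (x\<^sup>2)"
        and g'' = "\<lambda>x. 2 * inverse (x ^ 3)"])
     (use assms(2) in \<open>auto intro!: derivative_eq_intros continuous_intros
        simp: field_simps power2_eq_square power3_eq_cube\<close>)

lemma C2_circle_cmult:
  fixes f :: "real \<Rightarrow> real"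
  assumes "f \<in> C2_circle"
  shows "(\<lambda>x. t * f x) \<in> C2_circle"
    and "D (\<lambda>x. t * f x) = (\<lambda>x. t * D f x)"
  by (rule C2_circle_compose[OF assms, where g = "\<lambda>y. t * y" and g' = "\<lambda>_. t" and g'' = "\<lambda>_. 0"];
      auto intro!: derivative_eq_intros continuous_intros)+

lemma C2_circle_ln:
  fixes u :: "real \<Rightarrow> real"
  assumes "u \<in> C2_circle" "\<And>x. u x > 0"
  shows "(\<lambda>x. ln (u x)) \<in> C2_circle"
    and "D (\<lambda>x. ln (u x)) = (\<lambda>x. D u x / u x)"
    and "D (D (\<lambda>x. ln (u x))) = (\<lambda>x. D (D u) x / u x - (D u x / u x)\<^sup>2)"
proof -
  have *: "u x \<noteq> 0" for x using assms(2)[of x] by simp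
  note c = C2_circle_compose[OF assms(1), where g = ln and g' = inverse
        and g'' = "\<lambda>x. - inverse (x\<^sup>2)"]
  have h: "(ln has_real_derivative inverse (u x)) (at (u x))"
    "(inverse has_real_derivative - inverse ((u x)\<^sup>2)) (at (u x))"
    "continuous_on (range u) (\<lambda>x. - inverse (x\<^sup>2))" for x
    using assms(2)[of x] * by (auto intro!: derivative_eq_intros continuous_intros
        simp: field_simps power2_eq_square)
  show "(\<lambda>x. ln (u x)) \<in> C2_circle" by (rule c) (fact h)+
  have "D (\<lambda>x. ln (u x)) = (\<lambda>x. inverse (u x) * D u x)"  by (rule c) (fact h)+
  thus "D (\<lambda>x. ln (u x)) = (\<lambda>x. D u x / u x)" by (simp add: divide_inverse mult.commute)
  have "D (D (\<lambda>x. ln (u x))) = (\<lambda>x. - inverse ((u x)\<^sup>2) * (D u x)\<^sup>2 + inverse (u x) * D (D u) x)"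
    by (rule c) (fact h)+
  thus "D (D (\<lambda>x. ln (u x))) = (\<lambda>x. D (D u) x / u x - (D u x / u x)\<^sup>2)"
    by (simp add: divide_inverse power_mult_distrib power_inverse algebra_simps)
qed

text \<open>In terms of \<open>f = ln u\<close> the quotient is the drift \<open>b f'\<close> plus
  \<epsilon> times an expression quadratic in \<open>f'\<close>. For a fixed \<open>f\<close> the
  latter is a small perturbation; for an arbitrary \<open>u\<close> its square has the favourable
  sign.\<close>

lemma gen_exp:
  fixes f :: "real \<Rightarrow> real"
  assumes "f \<in> C2_circle"
  shows "gen a b \<epsilon> (\<lambda>x. exp (f x)) x / exp (f x) = \<epsilon> * a x * (D (D f) x + (D f x)\<^sup>2) + b x * D f x"
  unfolding gen_def C2_circle_exp(3)[OF assms] unfolding C2_circle_exp(2)[OF assms] by (simp add: field_simps)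

text \<open>The point is a maximum of \<open>ln u - ln v\<close>.\<close>

lemma gen_ratio_le:
  fixes u v :: "real \<Rightarrow> real"
  assumes u: "u \<in> C2_circle" "\<And>x. u x > 0" and v: "v \<in> C2_circle" "\<And>x. v x > 0"
    and "\<epsilon> \<ge> 0" "\<And>x. a x \<ge> 0"
  obtains x where "gen a b \<epsilon> u x / u x \<le> gen a b \<epsilon> v x / v x"
proof -
  note lu = C2_circle_ln[OF u] and lv = C2_circle_ln[OF v]
  have "(\<lambda>x. ln (u x) - ln (v x)) \<in> C0_circle"
    using C2_circle_C0[OF lu(1)] C2_circle_C0[OF lv(1)]
    by (auto simp: C0_circle_def intro!: continuous_on_diff)
  then obtain x where max: "\<And>y. ln (u y) - ln (v y) \<le> ln (u x) - ln (v x)"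
    using C0_circle_attains_max[of "\<lambda>x. ln (u x) - ln (v x)"] by blast
  have "((\<lambda>x. ln (u x) - ln (v x)) has_real_derivative (D u y / u y - D v y / v y)) (at y)" for y
    using DERIV_diff[OF C2_circle_DERIV(1)[OF lu(1)] C2_circle_DERIV(1)[OF lv(1)]]
    unfolding lu(2) lv(2) by simp
  moreover have "((\<lambda>y. D u y / u y - D v y / v y) has_real_derivative
      ((D (D u) x / u x - (D u x / u x)\<^sup>2) - (D (D v) x / v x - (D v x / v x)\<^sup>2))) (at x)"
    using DERIV_diff[OF C2_circle_DERIV(2)[OF lu(1), of x] C2_circle_DERIV(2)[OF lv(1), of x]]
    unfolding lu(3) lv(3) unfolding lu(2) lv(2) by simp
  ultimately have *: "D u x / u x - D v x / v x = 0"
    "(D (D u) x / u x - (D u x / u x)\<^sup>2) - (D (D v) x / v x - (D v x / v x)\<^sup>2) \<le> 0"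
    using DERIV_second_nonpos_at_max[of "\<lambda>x. ln (u x) - ln (v x)" "\<lambda>y. D u y / u y - D v y / v y"] max
    by blast+
  \<comment> \<open>The logarithmic derivatives agree at the maximum, so their squares
    cancel.\<close>
  hence "D (D u) x / u x \<le> D (D v) x / v x" by simp
  hence "\<epsilon> * a x * (D (D u) x / u x) \<le> \<epsilon> * a x * (D (D v) x / v x)"
    using assms(5,6) by (intro mult_left_mono) auto
  hence "\<epsilon> * a x * (D (D u) x / u x) + b x * (D u x / u x)
      \<le> \<epsilon> * a x * (D (D v) x / v x) + b x * (D v x / v x)"
    using * by simp
  thus ?thesis
    by (intro that[of x]) (simp add: gen_def add_divide_distrib)
qed

lemma Re_Im_C2_circle:
  fixes v :: "real \<Rightarrow> complex"
  assumes "v \<in> C2_circle"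
  shows "(\<lambda>x. Re (v x)) \<in> C2_circle" "D (\<lambda>x. Re (v x)) = (\<lambda>x. Re (D v x))"
    "D (D (\<lambda>x. Re (v x))) = (\<lambda>x. Re (D (D v) x))"
    "(\<lambda>x. Im (v x)) \<in> C2_circle" "D (\<lambda>x. Im (v x)) = (\<lambda>x. Im (D v x))"
    "D (D (\<lambda>x. Im (v x))) = (\<lambda>x. Im (D (D v) x))"
proof -
  have 0: "continuous_on UNIV (D (D v))"
    using C2_circle_DD_C0[OF assms] by (simp add: C0_circle_def)
  have 1: "Re (v (x + 1)) = Re (v x)" "Im (v (x + 1)) = Im (v x)" for x
    using C2_circle_periodic[OF assms] by simp_all
  have 2: "((\<lambda>x. Re (v x)) has_vector_derivative Re (D v x)) (at x)"
    "((\<lambda>x. Im (v x)) has_vector_derivative Im (D v x)) (at x)" for x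
    using C2_circle_D[OF assms, of x] by (simp_all add: has_vector_derivative_complex_iff
      has_real_derivative_iff_has_vector_derivative)
  have 3: "((\<lambda>x. Re (D v x)) has_vector_derivative Re (D (D v) x)) (at x)"
    "((\<lambda>x. Im (D v x)) has_vector_derivative Im (D (D v) x)) (at x)" for x
    using C2_circle_DD[OF assms, of x] by (simp_all add: has_vector_derivative_complex_iff
      has_real_derivative_iff_has_vector_derivative)
  have 4: "continuous_on UNIV (\<lambda>x. Re (D (D v) x))" "continuous_on UNIV (\<lambda>x. Im (D (D v) x))"
    by (intro continuous_intros 0)+
  show "(\<lambda>x. Re (v x)) \<in> C2_circle" "D (\<lambda>x. Re (v x)) = (\<lambda>x. Re (D v x))"
    "D (D (\<lambda>x. Re (v x))) = (\<lambda>x. Re (D (D v) x))"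
    using C2_circleI[OF 1(1) 2(1) 3(1) 4(1)] .
  show "(\<lambda>x. Im (v x)) \<in> C2_circle" "D (\<lambda>x. Im (v x)) = (\<lambda>x. Im (D v x))"
    "D (D (\<lambda>x. Im (v x))) = (\<lambda>x. Im (D (D v) x))"
    using C2_circleI[OF 1(2) 2(2) 3(2) 4(2)] .
qed

lemma of_real_C2_circle:
  fixes u :: "real \<Rightarrow> real"
  assumes "u \<in> C2_circle"
  shows "(\<lambda>x. complex_of_real (u x)) \<in> C2_circle"
    "D (\<lambda>x. complex_of_real (u x)) = (\<lambda>x. complex_of_real (D u x))"
    "D (D (\<lambda>x. complex_of_real (u x))) = (\<lambda>x. complex_of_real (D (D u) x))"
proof -
  have 0: "continuous_on UNIV (D (D u))"
    using C2_circle_DD_C0[OF assms] by (simp add: C0_circle_def)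
  have 1: "complex_of_real (u (x + 1)) = complex_of_real (u x)" for x
    using C2_circle_periodic[OF assms] by simp_all
  have 2: "((\<lambda>x. complex_of_real (u x)) has_vector_derivative complex_of_real (D u x)) (at x)" for x
    using C2_circle_D[OF assms, of x] by (simp add: has_vector_derivative_complex_iff
      has_real_derivative_iff_has_vector_derivative)
  have 3: "((\<lambda>x. complex_of_real (D u x)) has_vector_derivative complex_of_real (D (D u) x)) (at x)" for x
    using C2_circle_DD[OF assms, of x] by (simp add: has_vector_derivative_complex_iff
      has_real_derivative_iff_has_vector_derivative)
  have 4: "continuous_on UNIV (\<lambda>x. complex_of_real (D (D u) x))"
    by (intro continuous_intros 0)
  show "(\<lambda>x. complex_of_real (u x)) \<in> C2_circle"
    "D (\<lambda>x. complex_of_real (u x)) = (\<lambda>x. complex_of_real (D u x))"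
    "D (D (\<lambda>x. complex_of_real (u x))) = (\<lambda>x. complex_of_real (D (D u) x))"
    using C2_circleI[OF 1 2 3 4] .
qed

section \<open>Uniqueness of the principal eigenvalue\<close>

text \<open>If \<open>u > 0\<close> is an eigenfunction for \<open>\<kappa>\<close> and \<open>v\<close> one for \<open>z\<close>, then \<open>g = \<bar>v / u\<bar>\<^sup>2\<close> satisfies
  \<open>\<epsilon> a g'' + B g' = 2 \<epsilon> a \<bar>(v / u)'\<bar>\<^sup>2 + 2 Re (z - \<kappa>) g\<close> with \<open>B = b + 2 \<epsilon> a u' / u\<close>. The maximum
  principle gives \<open>Re z \<le> \<kappa>\<close>, and in the case of equality \<open>g\<close> is constant.\<close>

lemma eigenvalue_dominated:
  fixes u :: "real \<Rightarrow> real"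
  assumes u: "u \<in> C2_circle" "\<And>x. u x > 0"
    and eig: "\<And>x. gen a b \<epsilon> u x + c x * u x = \<kappa> * u x"
    and \<epsilon>: "\<epsilon> > 0" and a: "\<And>x. a x > 0"
    and cont: "continuous_on UNIV a" "continuous_on UNIV b"
    and z: "eigenvalue a b \<epsilon> c z"
  shows "Re z \<le> \<kappa>" "Re z = \<kappa> \<Longrightarrow> z = of_real \<kappa>"
proof -
  obtain v :: "real \<Rightarrow> complex" where v: "v \<in> C2_circle" "\<exists>x. v x \<noteq> 0"
    "\<And>x. gen a b \<epsilon> v x + c x *\<^sub>R v x = z * v x"
    using z unfolding eigenvalue_def by blast
  have u0: "u x \<noteq> 0" for x using u(2)[of x] by simp
  note iu = C2_circle_inverse[OF u(1) u0]
  \<comment> \<open>\<open>p\<close> and \<open>q\<close> are the real and imaginary parts of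
    \<open>v / u\<close>. Dividing by the positive eigenfunction eliminates the potential
    \<open>c\<close> and leaves only the constant \<open>z - \<kappa>\<close> at order zero.\<close>
  define p where "p x = Re (v x) * inverse (u x)" for x
  define q where "q x = Im (v x) * inverse (u x)" for x
  have p: "p \<in> C2_circle" and q: "q \<in> C2_circle"
    unfolding p_def q_def by (intro C2_circle_mult(1) Re_Im_C2_circle(1,4) v iu)+
  have rv: "(\<lambda>x. Re (v x)) = (\<lambda>x. u x * p x)" and iv: "(\<lambda>x. Im (v x)) = (\<lambda>x. u x * q x)"
    using u0 by (auto simp: p_def q_def)
  have Re: "\<epsilon> * a x * Re (D (D v) x) + b x * Re (D v x) + c x * (u x * p x)
      = Re z * (u x * p x) - Im z * (u x * q x)" for x
    using arg_cong[OF v(3)[of x], of Re] fun_cong[OF rv, of x] fun_cong[OF iv, of x]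
    by (simp add: gen_def)
  have Im: "\<epsilon> * a x * Im (D (D v) x) + b x * Im (D v x) + c x * (u x * q x)
      = Re z * (u x * q x) + Im z * (u x * p x)" for x
    using arg_cong[OF v(3)[of x], of Im] fun_cong[OF rv, of x] fun_cong[OF iv, of x]
    by (simp add: gen_def)
  have Dr: "Re (D v x) = D u x * p x + u x * D p x"
    "Re (D (D v) x) = D (D u) x * p x + 2 * D u x * D p x + u x * D (D p) x" for x
    using C2_circle_mult(2,3)[OF u(1) p, folded rv, THEN fun_cong, of x]
      Re_Im_C2_circle(2,3)[OF v(1), THEN fun_cong, of x] by simp_all
  have Di: "Im (D v x) = D u x * q x + u x * D q x"
    "Im (D (D v) x) = D (D u) x * q x + 2 * D u x * D q x + u x * D (D q) x" for x
    using C2_circle_mult(2,3)[OF u(1) q, folded iv, THEN fun_cong, of x]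
      Re_Im_C2_circle(5,6)[OF v(1), THEN fun_cong, of x] by simp_all
  have eig': "\<epsilon> * a x * D (D u) x + b x * D u x + c x * u x = \<kappa> * u x" for x
    using eig[of x] by (simp add: gen_def)
  \<comment> \<open>The equation is divided by \<open>\<epsilon> * a x\<close>: the leading
    coefficient becomes 1, and a primitive of \<open>B\<close> will provide an integrating
    factor.\<close>
  define B where "B x = b x / (\<epsilon> * a x) + 2 * D u x / u x" for x
  have ea: "\<epsilon> * a x > 0" for x using \<epsilon> a by simp
  have B: "B x * (u x * (\<epsilon> * a x)) = b x * u x + 2 * \<epsilon> * a x * D u x" for x
    using u0[of x] a[of x] \<epsilon> by (simp add: B_def field_simps)
  have divI: "X = Y / (\<epsilon> * a x)" if "X * (u x * (\<epsilon> * a x)) = u x * Y" for X Y x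
    using that u0[of x] a[of x] \<epsilon> by (simp add: eq_divide_eq mult_ac)
  have eqp: "D (D p) x + B x * D p x = ((Re z - \<kappa>) * p x - Im z * q x) / (\<epsilon> * a x)" for x
    by (rule divI) (use Re[of x] eig'[of x] B[of x] in \<open>unfold Dr, algebra\<close>)
  have eqq: "D (D q) x + B x * D q x = ((Re z - \<kappa>) * q x + Im z * p x) / (\<epsilon> * a x)" for x
    by (rule divI) (use Im[of x] eig'[of x] B[of x] in \<open>unfold Di, algebra\<close>)
  define g where "g x = p x * p x + q x * q x" for x
  define g' where "g' x = 2 * (p x * D p x + q x * D q x)" for x
  define g'' where "g'' x = 2 * (p x * D (D p) x + q x * D (D q) x + (D p x)\<^sup>2 + (D q x)\<^sup>2)" for x
  note d = C2_circle_DERIV[OF p] C2_circle_DERIV[OF q]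
  have g: "(g has_real_derivative g' x) (at x)" for x
    unfolding g_def g'_def by (auto intro!: derivative_eq_intros d)
  have g': "(g' has_real_derivative g'' x) (at x)" for x
    unfolding g'_def g''_def by (auto intro!: derivative_eq_intros d simp: power2_eq_square)
  \<comment> \<open>Weighting the two equations by \<open>p\<close> and \<open>q\<close> cancels the
    terms with \<open>Im z\<close>, so the modulus sees only the real part.\<close>
  have eqg: "g'' x + B x * g' x = 2 * ((D p x)\<^sup>2 + (D q x)\<^sup>2) + 2 * (Re z - \<kappa>) * g x / (\<epsilon> * a x)" for x
  proof -
    have "g'' x + B x * g' x = 2 * ((D p x)\<^sup>2 + (D q x)\<^sup>2)
        + 2 * (p x * (D (D p) x + B x * D p x) + q x * (D (D q) x + B x * D q x))"
      by (simp add: g'_def g''_def algebra_simps)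
    also have "\<dots> = 2 * ((D p x)\<^sup>2 + (D q x)\<^sup>2) + 2 * (Re z - \<kappa>) * g x / (\<epsilon> * a x)"
      unfolding eqp eqq g_def using ea[of x] by (simp add: divide_simps) (simp add: algebra_simps)
    finally show ?thesis .
  qed
  have "g \<in> C0_circle"
    using g C2_circle_periodic[OF p] C2_circle_periodic[OF q]
    by (auto simp: C0_circle_def g_def[abs_def] intro!: continuous_at_imp_continuous_on DERIV_isCont)
  then obtain x0 where x0: "\<And>y. g y \<le> g x0" using C0_circle_attains_max by blast
  have gpos: "g x0 > 0"
  proof -
    obtain y where "v y \<noteq> 0" using v(2) by blast
    hence "p y \<noteq> 0 \<or> q y \<noteq> 0" using u0[of y] by (auto simp: p_def q_def complex_eq_iff)
    hence "g y > 0" by (auto simp: g_def sum_squares_gt_zero_iff)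
    thus ?thesis using x0[of y] by simp
  qed
  have max: "g' x0 = 0" "g'' x0 \<le> 0"
    using DERIV_second_nonpos_at_max[OF g g' x0] by auto
  show le: "Re z \<le> \<kappa>"
  proof (rule ccontr)
    assume "\<not> Re z \<le> \<kappa>"
    hence "2 * (Re z - \<kappa>) * g x0 / (\<epsilon> * a x0) > 0" using gpos ea[of x0] by simp
    moreover have "2 * ((D p x0)\<^sup>2 + (D q x0)\<^sup>2) \<ge> 0" by simp
    ultimately show False using eqg[of x0] unfolding max(1) mult_zero_right using max(2) by linarith
  qed
  assume "Re z = \<kappa>"
  have "continuous_on UNIV B"
    unfolding B_def using cont C2_circle_C0[OF u(1)] C2_circle_D_C0[OF u(1)] \<epsilon> a u0
    by (auto simp: C0_circle_def less_imp_neq[symmetric] intro!: continuous_intros)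
  then obtain P where P: "\<And>x. (P has_real_derivative B x) (at x)"
    using continuous_antiderivative_real by blast
  \<comment> \<open>In the case of equality \<open>h\<close> is nondecreasing. It vanishes at the
    maximum \<open>x0\<close> and, as \<open>g'\<close> is periodic, at \<open>x0 + 1\<close>; hence
    it vanishes in between, and so does its derivative, a sum of squares times a positive
    factor.\<close>
  define h where "h x = g' x * exp (P x)" for x
  have h: "(h has_real_derivative 2 * ((D p x)\<^sup>2 + (D q x)\<^sup>2) * exp (P x)) (at x)" for x
  proof -
    have "(h has_real_derivative (g'' x + B x * g' x) * exp (P x)) (at x)"
      unfolding h_def by (auto intro!: derivative_eq_intros g' P simp: algebra_simps)
    thus ?thesis using eqg[of x] \<open>Re z = \<kappa>\<close> by simp
  qed
  have "g' (x0 + 1) = g' x0"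
    using C2_circle_periodic[OF p] C2_circle_periodic[OF q] C2_circle_D_C0[OF p] C2_circle_D_C0[OF q]
    by (simp add: g'_def C0_circle_def)
  hence h0: "h x0 = 0" "h (x0 + 1) = 0" using max by (simp_all add: h_def)
  have mono: "h x \<le> h y" if "x \<le> y" for x y
    using that by (rule DERIV_nonneg_imp_nondecreasing) (meson h exp_ge_zero mult_nonneg_nonneg
      sum_power2_ge_zero zero_le_numeral)
  have hz: "h x = 0" if "x \<in> {x0<..<x0+1}" for x
    using mono[of x0 x] mono[of x "x0 + 1"] that h0 by simp
  have in_zero: "f' = 0"
    if "(f has_real_derivative f') (at x)" "x \<in> {x0<..<x0+1}" "\<And>y. y \<in> {x0<..<x0+1} \<Longrightarrow> f y = 0"
    for f :: "real \<Rightarrow> real" and f' x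
  proof -
    have "(f has_real_derivative 0) (at x)"
      by (rule has_field_derivative_transform_within_open[of "\<lambda>_. 0" _ _ "{x0<..<x0+1}"])
         (use that in auto)
    thus ?thesis using that(1) DERIV_unique by blast
  qed
  have D0: "D p x = 0 \<and> D q x = 0" if "x \<in> {x0<..<x0+1}" for x
  proof -
    have "2 * ((D p x)\<^sup>2 + (D q x)\<^sup>2) * exp (P x) = 0"
      by (rule in_zero[OF h that hz])
    hence "(D p x)\<^sup>2 + (D q x)\<^sup>2 = 0" by (simp add: mult_eq_0_iff del: distrib_left_numeral)
    thus ?thesis by (simp only: sum_power2_eq_zero_iff)
  qed
  \<comment> \<open>At an interior point the second derivatives of \<open>p\<close> and
    \<open>q\<close> vanish too, so their equations reduce to \<open>Im z * q y = 0\<close> and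
    \<open>Im z * p y = 0\<close>, while \<open>g y = g x0 > 0\<close> keeps \<open>p y\<close> and
    \<open>q y\<close> from both being zero.\<close>
  define y where "y = x0 + 1/2"
  have y: "y \<in> {x0<..<x0+1}" by (simp add: y_def)
  have "D (D p) y = 0" "D (D q) y = 0"
    by (rule in_zero[OF d(2) y] in_zero[OF d(4) y]; use D0 in blast)+
  hence *: "Im z * q y = 0" "Im z * p y = 0"
    using eqp[of y] eqq[of y] D0[OF y] \<open>Re z = \<kappa>\<close> ea[of y] by auto
  have "g y = g x0"
  proof -
    obtain w where w: "x0 < w" "w < y" "g y - g x0 = (y - x0) * g' w"
      using MVT2[of x0 y g g'] g y by auto
    thus ?thesis using D0[of w] y by (simp add: g'_def)
  qed
  hence "Im z = 0" using * gpos by (auto simp: g_def)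
  thus "z = of_real \<kappa>" using \<open>Re z = \<kappa>\<close> by (simp add: complex_eq_iff)
qed

text \<open>The definite description demands uniqueness as well as maximality; the equality case of
  the domination lemma excludes nonreal eigenvalues on the line
  \<open>Re z = \<kappa>\<close>.\<close>

lemma principal_eigenvalue_eqI:
  fixes u :: "real \<Rightarrow> real"
  assumes u: "u \<in> C2_circle" "\<And>x. u x > 0"
    and eig: "\<And>x. gen a b \<epsilon> u x + c x * u x = \<kappa> * u x"
    and "\<epsilon> > 0" "\<And>x. a x > 0" "continuous_on UNIV a" "continuous_on UNIV b"
  shows "principal_eigenvalue a b \<epsilon> c = \<kappa>"
proof -
  have *: "eigenvalue a b \<epsilon> c (of_real \<kappa>)"
    unfolding eigenvalue_def
  proof (intro exI conjI allI)
    show "(\<lambda>x. complex_of_real (u x)) \<in> C2_circle" by (rule of_real_C2_circle[OF u(1)])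
    show "complex_of_real (u 0) \<noteq> 0" using u(2)[of 0] by simp
    fix x
    show "gen a b \<epsilon> (\<lambda>x. complex_of_real (u x)) x + c x *\<^sub>R complex_of_real (u x)
        = of_real \<kappa> * complex_of_real (u x)"
      using arg_cong[OF eig[of x], of complex_of_real]
      unfolding gen_def of_real_C2_circle(3)[OF u(1)] unfolding of_real_C2_circle(2)[OF u(1)] by (simp add: scaleR_conv_of_real)
  qed
  note dom = eigenvalue_dominated[OF assms]
  have "(THE z. eigenvalue a b \<epsilon> c z \<and> (\<forall>w. eigenvalue a b \<epsilon> c w \<longrightarrow> Re w \<le> Re z)) = of_real \<kappa>"
  proof (rule the_equality)
    show "eigenvalue a b \<epsilon> c (of_real \<kappa>) \<and>
        (\<forall>w. eigenvalue a b \<epsilon> c w \<longrightarrow> Re w \<le> Re (of_real \<kappa>))"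
      using * dom(1) by simp
  next
    fix z assume z: "eigenvalue a b \<epsilon> c z \<and> (\<forall>w. eigenvalue a b \<epsilon> c w \<longrightarrow> Re w \<le> Re z)"
    hence "Re z = \<kappa>" using * dom(1)[of z] by fastforce
    thus "z = of_real \<kappa>" using dom(2) z by blast
  qed
  thus ?thesis by (simp add: principal_eigenvalue_def)
qed

section \<open>Existence of the principal eigenvalue\<close>

text \<open>Rescaling to the fixed domain \<open>{0..1}\<close> treats both signs of
  \<open>x\<close> at once and turns continuity in \<open>x\<close> into continuity of an integral
  in a parameter.\<close>

lemma integral_rescaled:
  fixes f :: "real \<Rightarrow> 'a::euclidean_space"
  assumes F: "\<And>x. (F has_vector_derivative f x) (at x)"
  shows "x *\<^sub>R integral {0..1} (\<lambda>s. f (x * s)) = F x - F 0"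
proof -
  have "((\<lambda>s. F (x * s)) has_vector_derivative x *\<^sub>R f (x * s)) (at s within {0..1})" for s
  proof -
    have "((F \<circ> (\<lambda>s. x * s)) has_vector_derivative x *\<^sub>R f (x * s)) (at s)"
      by (rule vector_diff_chain_at) (auto intro!: derivative_eq_intros F simp: mult.commute)
    thus ?thesis by (simp add: o_def has_vector_derivative_at_within)
  qed
  hence "((\<lambda>s. x *\<^sub>R f (x * s)) has_integral F (x * 1) - F (x * 0)) {0..1}"
    by (intro fundamental_theorem_of_calculus) auto
  thus ?thesis by (simp add: integral_unique flip: integral_cmul)
qed

text \<open>The Picard map is a contraction for the norm weighted by \<open>exp (- 2 K \<bar>x\<bar>)\<close>. Treating the
  parameter \<open>p\<close> as an argument of the unknown function makes the solution continuous in \<open>p\<close>.\<close>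

lemma global_ODE_solution_param:
  fixes A :: "real \<Rightarrow> 'p::metric_space \<Rightarrow> 'b::euclidean_space \<Rightarrow> 'b"
  assumes cont: "continuous_on UNIV (\<lambda>(t, p, y). A t p y)"
    and lip: "\<And>t p y z. norm (A t p y - A t p z) \<le> K p * norm (y - z)"
    and zero: "\<And>t p. A t p 0 = 0"
    and K: "continuous_on UNIV K" "\<And>p. K p > 0"
  obtains U where "continuous_on UNIV (\<lambda>(x, p). U x p)" "\<And>p. U 0 p = y0"
    "\<And>x p. ((\<lambda>x. U x p) has_vector_derivative A x p (U x p)) (at x)"
proof -
  define W where "W x p = exp (2 * K p * \<bar>x\<bar>)" for x :: real and p
  have W: "W x p > 0" for x p by (simp add: W_def)
  have contW: "continuous_on UNIV (\<lambda>(x, p). W x p)"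
    unfolding W_def case_prod_unfold
    by (intro continuous_intros continuous_on_compose2[OF K(1)]) auto
  define f where "f V t p = A t p (W t p *\<^sub>R V (t, p))" for V :: "real \<times> 'p \<Rightarrow> 'b" and t p
  \<comment> \<open>The unknown is the solution divided by its weight, which makes it bounded and
    puts the problem into the complete space of bounded continuous functions of
    \<open>(x, p)\<close>.\<close>
  define T where "T V = (\<lambda>(x, p). inverse (W x p) *\<^sub>R (y0 + x *\<^sub>R integral {0..1} (\<lambda>s. f V (x * s) p)))"
    for V :: "real \<times> 'p \<Rightarrow> 'b"
  have contf: "continuous_on UNIV (\<lambda>(t, p). f V t p)" if "continuous_on UNIV V" for V
  proof -
    have "continuous_on UNIV (\<lambda>(t, p). (t, p, W t p *\<^sub>R V (t, p)))"
      using that contW by (auto simp: case_prod_unfold intro!: continuous_intros)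
    from continuous_on_compose2[OF cont this] show ?thesis
      by (simp add: f_def case_prod_unfold)
  qed
  have contT: "continuous_on UNIV (T V)" if "continuous_on UNIV V" for V
  proof -
    have "continuous_on (UNIV \<times> cbox 0 1) (\<lambda>(xp, s). f V (fst xp * s) (snd xp))"
      unfolding case_prod_unfold
      by (rule continuous_on_compose2[OF contf[OF that, unfolded case_prod_unfold],
            where f = "\<lambda>z. (fst (fst z) * snd z, snd (fst z))", simplified])
         (intro continuous_intros)
    from integral_continuous_on_param[OF this]
    have "continuous_on UNIV (\<lambda>xp. integral {0..1} (\<lambda>s. f V (fst xp * s) (snd xp)))"
      by simp
    thus ?thesis
      using contW W unfolding T_def case_prod_unfold
      by (intro continuous_intros) (auto simp: less_imp_neq[symmetric])
  qed
  have intf: "(\<lambda>s. f V (x * s) p) integrable_on {0..1}" if "continuous_on UNIV V" for V x p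
    by (intro integrable_continuous_real
          continuous_on_compose2[OF contf[OF that], where f = "\<lambda>s. (x * s, p)", simplified])
       (intro continuous_intros)
  \<comment> \<open>Integrating \<open>K exp (2 K t)\<close> from 0 to \<open>\<bar>x\<bar>\<close>
    gives less than half the weight at \<open>x\<close>; this half is the contraction
    constant.\<close>
  have key: "norm (x *\<^sub>R integral {0..1} (\<lambda>s. g (x * s))) \<le> M / 2 * W x p"
    if g: "\<And>s. norm (g s) \<le> K p * (W s p * M)" "(\<lambda>s. g (x * s)) integrable_on {0..1}" and "M \<ge> 0"
    for g :: "real \<Rightarrow> 'b" and x p M
  proof -
    have *: "((\<lambda>s. \<bar>x\<bar> * (K p * (W (x * s) p * M))) has_integral M/2 * W x p - M/2 * W 0 p) {0..1}"
    proof -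
      have "((\<lambda>s. M/2 * exp (2 * K p * (\<bar>x\<bar> * s))) has_vector_derivative
          \<bar>x\<bar> * (K p * (exp (2 * K p * (\<bar>x\<bar> * s)) * M))) (at s within {0..1})" for s
        unfolding has_real_derivative_iff_has_vector_derivative[symmetric]
        by (auto intro!: derivative_eq_intros)
      hence "((\<lambda>s. \<bar>x\<bar> * (K p * (exp (2 * K p * (\<bar>x\<bar> * s)) * M))) has_integral
          M/2 * exp (2 * K p * (\<bar>x\<bar> * 1)) - M/2 * exp (2 * K p * (\<bar>x\<bar> * 0))) {0..1}"
        by (intro fundamental_theorem_of_calculus) auto
      thus ?thesis unfolding W_def
        by (rule has_integral_eq_rhs[OF has_integral_eq, rotated]) (auto simp: abs_mult)
    qed
    have "norm (integral {0..1} (\<lambda>s. x *\<^sub>R g (x * s))) \<le> integral {0..1} (\<lambda>s. \<bar>x\<bar> * (K p * (W (x * s) p * M)))"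
      by (rule integral_norm_bound_integral)
         (use g * in \<open>auto intro!: integrable_cmul mult_left_mono\<close>)
    also have "\<dots> = M/2 * W x p - M/2 * W 0 p" using * by (rule integral_unique)
    also have "\<dots> \<le> M/2 * W x p" using W[of 0 p] \<open>M \<ge> 0\<close> by simp
    finally show ?thesis by simp
  qed
  have bound: "norm (f V s p) \<le> K p * (W s p * M)"
    if "\<And>z. norm (V z) \<le> M" for V M s p
  proof -
    have "norm (f V s p) \<le> K p * norm (W s p *\<^sub>R V (s, p))"
      using lip[of s p "W s p *\<^sub>R V (s, p)" 0] by (simp add: f_def zero)
    also have "\<dots> \<le> K p * (W s p * M)"
      using W[of s p] K(2)[of p] that[of "(s, p)"] by (simp add: mult_left_mono)
    finally show ?thesis .
  qed
  have Tb: "T (apply_bcontfun V) \<in> bcontfun" for V :: "(real \<times> 'p) \<Rightarrow>\<^sub>C 'b"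
  proof -
    obtain M where M: "\<And>z. norm (apply_bcontfun V z) \<le> M"
      using bounded_apply_bcontfun[of V] unfolding bounded_iff by blast
    have "M \<ge> 0" using M[of undefined] norm_ge_zero order_trans by blast
    have "norm (T (apply_bcontfun V) (x, p)) \<le> norm y0 + M / 2" for x p
    proof -
      have 1: "inverse (W x p) \<le> 1" using K(2)[of p] by (simp add: W_def inverse_le_1_iff)
      have 2: "norm (x *\<^sub>R integral {0..1} (\<lambda>s. f (apply_bcontfun V) (x * s) p)) \<le> M / 2 * W x p"
        by (rule key[of "\<lambda>s. f (apply_bcontfun V) s p" p M x, OF bound[OF M] intf \<open>M \<ge> 0\<close>]) auto
      have "norm (T (apply_bcontfun V) (x, p)) \<le> inverse (W x p) * (norm y0 + M / 2 * W x p)"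
        unfolding T_def using W[of x p] 2
        by (auto intro!: mult_left_mono norm_triangle_mono)
      also have "\<dots> = inverse (W x p) * norm y0 + M / 2" using W[of x p] by (simp add: field_simps)
      also have "\<dots> \<le> norm y0 + M / 2" using mult_right_mono[OF 1, of "norm y0"] by simp
      finally show ?thesis .
    qed
    thus ?thesis
      using contT[of "apply_bcontfun V"] by (auto simp: bcontfun_def bounded_iff)
  qed
  define \<Phi> where "\<Phi> V = Bcontfun (T (apply_bcontfun V))" for V :: "(real \<times> 'p) \<Rightarrow>\<^sub>C 'b"
  have \<Phi>: "apply_bcontfun (\<Phi> V) = T (apply_bcontfun V)" for V
    unfolding \<Phi>_def by (rule Bcontfun_inverse[OF Tb])
  have "dist (\<Phi> V) (\<Phi> V') \<le> 1/2 * dist V V'" for V V'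
  proof (rule dist_bound)
    fix z :: "real \<times> 'p"
    obtain x p where z: "z = (x, p)" by fastforce
    let ?M = "dist V V'"
    have b: "norm (f (apply_bcontfun V) s p - f (apply_bcontfun V') s p) \<le> K p * (W s p * ?M)" for s
    proof -
      have "norm (f (apply_bcontfun V) s p - f (apply_bcontfun V') s p) \<le> K p * norm (W s p *\<^sub>R apply_bcontfun V (s, p) - W s p *\<^sub>R apply_bcontfun V' (s, p))"
        unfolding f_def by (rule lip)
      also have "\<dots> = K p * (W s p * dist (apply_bcontfun V (s, p)) (apply_bcontfun V' (s, p)))"
        using W[of s p] by (simp add: dist_norm flip: scaleR_diff_right)
      also have "\<dots> \<le> K p * (W s p * ?M)"
        using W[of s p] K(2)[of p] dist_bounded[of V "(s, p)" V'] by (simp add: mult_left_mono)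
      finally show ?thesis .
    qed
    have "T (apply_bcontfun V) (x, p) - T (apply_bcontfun V') (x, p)
        = inverse (W x p) *\<^sub>R (x *\<^sub>R integral {0..1} (\<lambda>s. f (apply_bcontfun V) (x * s) p - f (apply_bcontfun V') (x * s) p))"
      by (simp add: T_def Henstock_Kurzweil_Integration.integral_diff intf flip: scaleR_diff_right)
    also have "norm \<dots> \<le> inverse (W x p) * (?M / 2 * W x p)"
      unfolding norm_scaleR[of "inverse _"]
      using W[of x p] key[of "\<lambda>s. f (apply_bcontfun V) s p - f (apply_bcontfun V') s p" p ?M x, OF b integrable_diff[OF intf intf]]
      by (auto intro!: mult_left_mono)
    also have "\<dots> = 1/2 * ?M" using W[of x p] by simp
    finally show "dist (apply_bcontfun (\<Phi> V) z) (apply_bcontfun (\<Phi> V') z) \<le> 1/2 * ?M"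
      by (simp add: \<Phi> z dist_norm)
  qed
  hence "\<exists>!V. \<Phi> V = V"
    using banach_fix_type[of "1/2" \<Phi>] by simp
  then obtain V where "\<Phi> V = V" by blast
  hence V: "T (apply_bcontfun V) (x, p) = apply_bcontfun V (x, p)" for x p by (metis \<Phi>)
  define U where "U x p = W x p *\<^sub>R apply_bcontfun V (x, p)" for x p
  have U: "U x p = y0 + x *\<^sub>R integral {0..1} (\<lambda>s. A (x * s) p (U (x * s) p))" for x p
  proof -
    have "U x p = W x p *\<^sub>R T (apply_bcontfun V) (x, p)" by (simp add: U_def V)
    also have "\<dots> = y0 + x *\<^sub>R integral {0..1} (\<lambda>s. f (apply_bcontfun V) (x * s) p)"
      using W[of x p] by (simp add: T_def)
    finally show ?thesis by (simp add: f_def U_def)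
  qed
  have "continuous_on UNIV (\<lambda>(x, p). U x p)"
    unfolding U_def using contW by (auto simp: case_prod_unfold intro!: continuous_intros)
  moreover have "((\<lambda>x. U x p) has_vector_derivative A x p (U x p)) (at x)" for x p
  proof -
    \<comment> \<open>The fixed point is so far only continuous; the integral equation identifies it
      with a primitive of a continuous function.\<close>
    have "continuous_on UNIV (\<lambda>t. A t p (U t p))"
      using continuous_on_compose2[OF contf[of "apply_bcontfun V"], where f = "\<lambda>t. (t, p)" and s = UNIV]
      by (simp add: f_def U_def continuous_on_Pair)
    then obtain F where F: "\<And>t. (F has_vector_derivative A t p (U t p)) (at t)"
      using continuous_antiderivative by blast
    have eq: "y0 + (F t - F 0) = U t p" for t
      using U[of t p] integral_rescaled[OF F, of t] by simp
    have "((\<lambda>x. y0 + (F x - F 0)) has_vector_derivative A x p (U x p)) (at x)"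
      using F[of x] by (auto intro!: derivative_eq_intros)
    thus ?thesis unfolding eq .
  qed
  moreover have "U 0 p = y0" for p by (subst U) simp
  ultimately show ?thesis using that[of U] by blast
qed

text \<open>Here \<open>u\<close> and \<open>v\<close> stand for \<open>u\<close> and \<open>u'\<close> in \<open>u'' = q u - \<beta> u'\<close>, \<open>q = r (l - c)\<close>.\<close>

lemma second_order_solution_param:
  fixes \<beta> r c :: "real \<Rightarrow> real"
  assumes "\<beta> \<in> C0_circle" "r \<in> C0_circle" "c \<in> C0_circle"
  obtains u v where "continuous_on UNIV (\<lambda>(x, l). u x l)" "continuous_on UNIV (\<lambda>(x, l). v x l)"
    "\<And>l. u 0 l = u0" "\<And>l. v 0 l = v0"
    "\<And>x l. ((\<lambda>x. u x l) has_real_derivative v x l) (at x)"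
    "\<And>x l. ((\<lambda>x. v x l) has_real_derivative r x * (l - c x) * u x l - \<beta> x * v x l) (at x)"
proof -
  obtain B1 where B1: "B1 > 0" "\<And>x. \<bar>\<beta> x\<bar> \<le> B1"
    using C0_circle_bounded[OF assms(1)] by (metis real_norm_def)
  obtain B2 where B2: "B2 > 0" "\<And>x. \<bar>r x\<bar> \<le> B2"
    using C0_circle_bounded[OF assms(2)] by (metis real_norm_def)
  obtain B3 where B3: "B3 > 0" "\<And>x. \<bar>c x\<bar> \<le> B3"
    using C0_circle_bounded[OF assms(3)] by (metis real_norm_def)
  \<comment> \<open>The 1 bounds the first component of \<open>A\<close>, the other terms the
    second. The growth in \<open>l\<close> is the reason for a Lipschitz constant that depends on
    the parameter.\<close>
  define K where "K l = 1 + B1 + B2 * (\<bar>l\<bar> + B3)" for l :: real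
  define A where "A t l y = (snd y, r t * (l - c t) * fst y - \<beta> t * snd y)"
    for t l and y :: "real \<times> real"
  have c: "continuous_on S (\<lambda>x. \<beta> (f x))" "continuous_on S (\<lambda>x. r (f x))" "continuous_on S (\<lambda>x. c (f x))"
    if "continuous_on S f" for f and S :: "(real \<times> real \<times> real \<times> real) set"
    using assms that by (auto simp: C0_circle_def intro: continuous_on_compose2)
  have "continuous_on UNIV (\<lambda>(t, l, y). A t l y)"
    unfolding A_def case_prod_unfold by (intro continuous_intros c)
  moreover have "norm (A t l y - A t l z) \<le> K l * norm (y - z)" for t l y z
  proof -
    have f: "\<bar>fst (y - z)\<bar> \<le> norm (y - z)" and s: "\<bar>snd (y - z)\<bar> \<le> norm (y - z)"
      using norm_fst_le[of "fst (y - z)" "snd (y - z)"] norm_snd_le[of "snd (y - z)" "fst (y - z)"]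
      by (simp_all only: prod.collapse real_norm_def)
    have "norm (A t l y - A t l z)
        \<le> norm (snd (y - z)) + norm (r t * (l - c t) * fst (y - z) - \<beta> t * snd (y - z))"
      by (rule order_trans[OF _ norm_Pair_le]) (simp add: A_def algebra_simps)
    also have "\<dots> \<le> \<bar>snd (y - z)\<bar> + (\<bar>r t * (l - c t)\<bar> * \<bar>fst (y - z)\<bar> + \<bar>\<beta> t\<bar> * \<bar>snd (y - z)\<bar>)"
      by (simp add: abs_mult[symmetric])
    also have "\<dots> \<le> norm (y - z) + (B2 * (\<bar>l\<bar> + B3) * norm (y - z) + B1 * norm (y - z))"
    proof (intro add_mono mult_mono)
      show "\<bar>r t * (l - c t)\<bar> \<le> B2 * (\<bar>l\<bar> + B3)"
        unfolding abs_mult using B2 B3(2)[of t] by (intro mult_mono) auto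
    qed (use f s B1 B2 B3 in auto)
    finally show ?thesis by (simp add: K_def algebra_simps)
  qed
  moreover have "A t l 0 = 0" for t l by (simp add: A_def zero_prod_def)
  moreover have "continuous_on UNIV K" unfolding K_def by (intro continuous_intros)
  moreover have "K l > 0" for l
    using B1 B2 B3 by (simp add: K_def add_pos_nonneg)
  ultimately obtain U where U: "continuous_on UNIV (\<lambda>(x, p). U x p)" "\<And>p. U 0 p = (u0, v0)"
    "\<And>x p. ((\<lambda>x. U x p) has_vector_derivative A x p (U x p)) (at x)"
    by (rule global_ODE_solution_param) blast
  show ?thesis
  proof (rule that[of "\<lambda>x l. fst (U x l)" "\<lambda>x l. snd (U x l)"])
    show "continuous_on UNIV (\<lambda>(x, l). fst (U x l))" "continuous_on UNIV (\<lambda>(x, l). snd (U x l))"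
      using U(1) by (auto simp: case_prod_unfold intro!: continuous_intros)
    show "((\<lambda>x. fst (U x l)) has_real_derivative snd (U x l)) (at x)" for x l
      using bounded_linear.has_vector_derivative[OF bounded_linear_fst U(3)[of l x]]
      by (simp add: has_real_derivative_iff_has_vector_derivative A_def)
    show "((\<lambda>x. snd (U x l)) has_real_derivative
        r x * (l - c x) * fst (U x l) - \<beta> x * snd (U x l)) (at x)" for x l
      using bounded_linear.has_vector_derivative[OF bounded_linear_snd U(3)[of l x]]
      by (simp add: has_real_derivative_iff_has_vector_derivative A_def)
  qed (use U(2) in auto)
qed

text \<open>Abel's identity with its integrating factor. It keeps a fundamental system independent
  and, applied to a solution with zero initial data, takes the place of a uniqueness
  theorem.\<close>

lemma fundamental_system_wronskian:
  fixes y1 y1' y2 y2' \<beta> q :: "real \<Rightarrow> real"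
  assumes y1: "\<And>x. (y1 has_real_derivative y1' x) (at x)"
    and y1': "\<And>x. (y1' has_real_derivative q x * y1 x - \<beta> x * y1' x) (at x)"
    and y2: "\<And>x. (y2 has_real_derivative y2' x) (at x)"
    and y2': "\<And>x. (y2' has_real_derivative q x * y2 x - \<beta> x * y2' x) (at x)"
    and P: "\<And>x. (P has_real_derivative \<beta> x) (at x)"
  shows "(y1 x * y2' x - y1' x * y2 x) * exp (P x) = (y1 0 * y2' 0 - y1' 0 * y2 0) * exp (P 0)"
proof -
  have "((\<lambda>x. (y1 x * y2' x - y1' x * y2 x) * exp (P x)) has_real_derivative 0) (at x)" for x
    by (auto intro!: derivative_eq_intros y1 y1' y2 y2' P simp: algebra_simps)
  thus ?thesis
    using DERIV_isconst_all[of "\<lambda>x. (y1 x * y2' x - y1' x * y2 x) * exp (P x)" x 0] by blast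
qed

text \<open>The eigenvalue \<open>l\<close> is a zero of \<open>F l = - det (M l - 1)\<close>, where \<open>M l\<close> is the monodromy matrix.
  If \<open>y2 > 0\<close> on \<open>(0,1]\<close> (\<open>y2\<close> is the solution with \<open>y2 0 = 0\<close>, \<open>y2' 0 = 1\<close>), then there is a unique
  solution \<open>u\<close> with \<open>u 0 = u 1 = 1\<close>; it is positive, and \<open>F l = (u' 1 - u' 0) * y2 1\<close>.
  Hence \<open>F l \<ge> 0\<close> for \<open>l\<close> above the maximum of \<open>c\<close>. Going down from there, either \<open>y2 > 0\<close>
  persists until \<open>l\<close> is below the minimum of \<open>c\<close>, where \<open>F l \<le> 0\<close>, or it fails first at some \<open>l\<close>
  with \<open>y2 1 = 0\<close>, where \<open>M l\<close> is triangular with a negative diagonal and \<open>F l < 0\<close>.\<close>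

lemma positive_periodic_solution:
  fixes \<beta> r c :: "real \<Rightarrow> real"
  assumes \<beta>: "\<beta> \<in> C0_circle" and r: "r \<in> C0_circle" "\<And>x. r x > 0" and c: "c \<in> C0_circle"
  obtains l u u' where "\<And>x. u x > 0" "\<And>x. u (x + 1) = u x"
    "\<And>x. (u has_real_derivative u' x) (at x)"
    "\<And>x. (u' has_real_derivative r x * (l - c x) * u x - \<beta> x * u' x) (at x)"
proof -
  obtain y1 y1' where cy1: "continuous_on UNIV (\<lambda>(x, l). y1 x l)" "continuous_on UNIV (\<lambda>(x, l). y1' x l)"
    and i1: "\<And>l. y1 0 l = 1" "\<And>l. y1' 0 l = 0"
    and y1: "\<And>x l. ((\<lambda>x. y1 x l) has_real_derivative y1' x l) (at x)"
    and y1': "\<And>x l. ((\<lambda>x. y1' x l) has_real_derivative r x * (l - c x) * y1 x l - \<beta> x * y1' x l) (at x)"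
    using second_order_solution_param[OF \<beta> r(1) c] by blast
  obtain y2 y2' where cy2: "continuous_on UNIV (\<lambda>(x, l). y2 x l)" "continuous_on UNIV (\<lambda>(x, l). y2' x l)"
    and i2: "\<And>l. y2 0 l = 0" "\<And>l. y2' 0 l = 1"
    and y2: "\<And>x l. ((\<lambda>x. y2 x l) has_real_derivative y2' x l) (at x)"
    and y2': "\<And>x l. ((\<lambda>x. y2' x l) has_real_derivative r x * (l - c x) * y2 x l - \<beta> x * y2' x l) (at x)"
    using second_order_solution_param[OF \<beta> r(1) c] by blast
  have "continuous_on UNIV \<beta>" using \<beta> by (simp add: C0_circle_def)
  then obtain P where P: "\<And>x. (P has_real_derivative \<beta> x) (at x)"
    using continuous_antiderivative_real by blast
  define W where "W x l = y1 x l * y2' x l - y1' x l * y2 x l" for x l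
  have Wpos: "W x l > 0" for x l
  proof -
    have "W x l * exp (P x) = exp (P 0)"
      unfolding W_def using fundamental_system_wronskian[OF y1 y1' y2 y2' P, of x l] i1 i2 by simp
    thus ?thesis by (metis exp_gt_zero zero_less_mult_pos2)
  qed

  \<comment> \<open>\<open>h\<close> is \<open>y2 x l / x\<close> continued to \<open>x = 0\<close>.
    With the zero at 0 divided out, positivity is a condition on a compact interval, to which
    compactness in \<open>(x, l)\<close> applies.\<close>
  define h where "h = (\<lambda>(x, l). integral {0..1} (\<lambda>s. y2' (x * s) l))"
  have ch: "continuous_on S h" for S
  proof -
    have "continuous_on (UNIV \<times> cbox 0 1) (\<lambda>(xl, s). y2' (fst xl * s) (snd xl))"
      unfolding case_prod_unfold
      by (rule continuous_on_compose2[OF cy2(2)[unfolded case_prod_unfold],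
            where f = "\<lambda>z. (fst (fst z) * snd z, snd (fst z))", simplified])
         (intro continuous_intros)
    from integral_continuous_on_param[OF this] have "continuous_on UNIV h"
      by (simp add: h_def case_prod_unfold)
    thus ?thesis by (rule continuous_on_subset) simp
  qed
  have h_cont1: "isCont (\<lambda>x. h (x, l)) x" and h_cont2: "isCont (\<lambda>l. h (x, l)) l" for x l
  proof -
    have "continuous_on UNIV (\<lambda>x. h (x, l))" "continuous_on UNIV (\<lambda>l. h (x, l))"
      by (rule continuous_on_compose2[OF ch[of UNIV]]; intro continuous_intros subset_UNIV)+
    thus "isCont (\<lambda>x. h (x, l)) x" "isCont (\<lambda>l. h (x, l)) l"
      by (simp_all add: continuous_on_eq_continuous_at)
  qed
  have y2h: "y2 x l = x * h (x, l)" for x l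
    using integral_rescaled[of "\<lambda>x. y2 x l" "\<lambda>x. y2' x l" x] y2 i2
    by (simp add: h_def has_real_derivative_iff_has_vector_derivative)
  have h0: "h (0, l) = 1" for l by (simp add: h_def i2)

  \<comment> \<open>The slope at 0 for which the solution starting at 1 returns to 1; this is
    meaningful only if \<open>y2 1 l\<close> is nonzero, as \<open>good l\<close> ensures.\<close>
  define s where "s l = (1 - y1 1 l) / y2 1 l" for l
  define u where "u l x = y1 x l + s l * y2 x l" for l x
  define u' where "u' l x = y1' x l + s l * y2' x l" for l x
  have u: "(u l has_real_derivative u' l x) (at x)" for l x
    unfolding u_def u'_def by (auto intro!: derivative_eq_intros y1 y2)
  have u': "(u' l has_real_derivative r x * (l - c x) * u l x - \<beta> x * u' l x) (at x)" for l x
    unfolding u_def u'_def by (auto intro!: derivative_eq_intros y1' y2' simp: algebra_simps)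
  have u0: "u l 0 = 1" for l by (simp add: u_def i1 i2)
  \<comment> \<open>For the 2 by 2 monodromy matrix, \<open>- det (M - 1)\<close> is the trace minus
    1 minus the determinant, and the determinant is \<open>W 1 l\<close>.\<close>
  define F where "F l = y1 1 l + y2' 1 l - 1 - W 1 l" for l

  define good where "good l \<longleftrightarrow> (\<forall>x\<in>{0..1}. h (x, l) > 0)" for l
  have good_y2: "y2 x l > 0" if "good l" "0 < x" "x \<le> 1" for x l
    using that by (simp add: y2h good_def)
  have u1: "u l 1 = 1" if "good l" for l
    using good_y2[OF that, of 1] by (simp add: u_def s_def)
  have FG: "F l = (u' l 1 - u' l 0) * y2 1 l" if "good l" for l
  proof -
    have "s l * y2 1 l = 1 - y1 1 l" using good_y2[OF that, of 1] by (simp add: s_def)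
    thus ?thesis by (simp add: F_def W_def u'_def i1 i2) algebra
  qed
  have u_pos: "u l x > 0" if "good l" "0 \<le> x" "x \<le> 1" for l x
  proof (cases "x = 0")
    case False
    \<comment> \<open>Since \<open>u l\<close> is \<open>y1\<close> plus a multiple of
      \<open>y2\<close>, its Wronskian with \<open>y2\<close> is again \<open>W > 0\<close>; hence
      the quotient decreases towards its positive value at 1.\<close>
    have "u l 1 / y2 1 l \<le> u l x / y2 x l"
    proof (rule DERIV_nonpos_imp_nonincreasing[OF \<open>x \<le> 1\<close>])
      fix t assume t: "x \<le> t" "t \<le> 1"
      have pos: "y2 t l > 0" using good_y2[OF that(1)] t False that by simp
      have "((\<lambda>x. u l x / y2 x l) has_real_derivative
          (u' l t * y2 t l - u l t * y2' t l) / (y2 t l * y2 t l)) (at t)"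
        using pos by (intro DERIV_divide u y2) auto
      moreover have "u' l t * y2 t l - u l t * y2' t l = - W t l"
        by (simp add: u_def u'_def W_def algebra_simps)
      moreover have "- W t l / (y2 t l * y2 t l) \<le> 0" using Wpos[of t l] pos by simp
      ultimately show "\<exists>y. ((\<lambda>x. u l x / y2 x l) has_real_derivative y) (at t) \<and> y \<le> 0"
        by auto
    qed
    moreover have "u l 1 / y2 1 l > 0" using u1 good_y2 that by simp
    ultimately have "u l x / y2 x l > 0" by linarith
    thus ?thesis using good_y2[OF that(1), of x] False that by (simp add: zero_less_divide_iff)
  qed (simp add: u0)

  have uE: "((\<lambda>x. u' l x * exp (P x)) has_real_derivative r x * (l - c x) * u l x * exp (P x)) (at x)"
    for l x by (auto intro!: derivative_eq_intros u' P simp: algebra_simps)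
  have rolle: "\<exists>z. 0 < z \<and> z < 1 \<and> u' l z = 0" if "good l" for l
    using MVT2[of 0 1 "u l" "u' l"] u u0 u1[OF that] by auto

  obtain xmax where xmax: "\<And>y. c y \<le> c xmax" using C0_circle_attains_max[OF c] by blast
  have "(\<lambda>x. - c x) \<in> C0_circle" using c by (auto simp: C0_circle_def intro: continuous_on_minus)
  then obtain xmin where xmin: "\<And>y. c xmin \<le> c y"
    using C0_circle_attains_max[of "\<lambda>x. - c x"] by auto
  define lo where "lo = c xmin"
  define hi where "hi = c xmax"
  have lohi: "lo \<le> hi" using xmin by (simp add: lo_def hi_def)

  have good_above: "good l" if "l \<ge> hi" for l
    unfolding good_def
  proof (rule ballI, rule ccontr)
    fix x :: real assume x: "x \<in> {0..1}" and "\<not> h (x, l) > 0"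
    have "\<exists>z. 0 \<le> z \<and> z \<le> x \<and> h (z, l) = 0"
      by (rule IVT2') (use x \<open>\<not> h (x, l) > 0\<close> in \<open>auto simp: h0 intro!: continuous_on_compose2[OF ch] continuous_intros\<close>)
    then obtain z where z: "0 \<le> z" "z \<le> x" "h (z, l) = 0" by blast
    hence "z > 0" using h0[of l] by (cases "z = 0") auto
    \<comment> \<open>For \<open>l\<close> above \<open>c\<close> the product
      \<open>y2 * y2' * exp P\<close> is nondecreasing from 0, so the square of \<open>y2\<close> is
      nondecreasing. A zero at \<open>z\<close> would force \<open>y2 = 0\<close> on all of
      \<open>(0, z)\<close>, against \<open>h (0, l) = 1\<close>.\<close>
    define e where "e t = y2 t l * y2' t l * exp (P t)" for t
    have "(e has_real_derivative ((y2' t l)\<^sup>2 + r t * (l - c t) * (y2 t l)\<^sup>2) * exp (P t)) (at t)" for t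
      unfolding e_def by (auto intro!: derivative_eq_intros y2 y2' P simp: algebra_simps power2_eq_square)
    moreover have "((y2' t l)\<^sup>2 + r t * (l - c t) * (y2 t l)\<^sup>2) * exp (P t) \<ge> 0" for t
      using r(2)[of t] xmax[of t] that by (auto simp: hi_def intro!: mult_nonneg_nonneg add_nonneg_nonneg)
    ultimately have e: "e 0 \<le> e t" if "0 \<le> t" for t
      using that by (meson DERIV_nonneg_imp_nondecreasing)
    have mono: "(y2 t l)\<^sup>2 \<le> (y2 z l)\<^sup>2" if "0 \<le> t" "t \<le> z" for t
    proof (rule DERIV_nonneg_imp_nondecreasing[OF \<open>t \<le> z\<close>])
      fix w assume "t \<le> w" "w \<le> z"
      hence "y2 w l * y2' w l \<ge> 0"
        using e[of w] that by (simp add: e_def i2 zero_le_mult_iff)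
      moreover have "((\<lambda>t. (y2 t l)\<^sup>2) has_real_derivative 2 * (y2 w l * y2' w l)) (at w)"
        by (auto intro!: derivative_eq_intros y2)
      ultimately show "\<exists>y. ((\<lambda>t. (y2 t l)\<^sup>2) has_real_derivative y) (at w) \<and> 0 \<le> y" by auto
    qed
    have zero: "y2 t l = 0" if "0 < t" "t < z" for t
      using mono[of t] that z(3) by (simp add: y2h[of z])
    have "(\<lambda>t. h (t, l)) \<midarrow>0\<rightarrow> h (0, l)"
      using h_cont1 by (simp add: isCont_def)
    hence "eventually (\<lambda>t. h (t, l) > 0) (at_right 0)"
      using h0 by (auto intro!: order_tendstoD(1) simp: filterlim_at_split)
    moreover have "eventually (\<lambda>t. t < z \<and> 0 < t) (at_right 0)"
      using \<open>z > 0\<close> by (auto simp: eventually_at_right_less eventually_conj_iff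
          intro: eventually_at_rightI[of 0 z])
    ultimately have "eventually (\<lambda>t. False) (at_right (0::real))"
    proof eventually_elim
      case (elim t)
      thus ?case using zero[of t] by (simp add: y2h)
    qed
    thus False by simp
  qed

  have F_hi: "F hi \<ge> 0"
  proof -
    have g: "good hi" using good_above by simp
    obtain z where z: "0 < z" "z < 1" "u' hi z = 0" using rolle[OF g] by blast
    \<comment> \<open>As \<open>hi - c\<close> is nonnegative and \<open>u\<close> positive,
      \<open>u' * exp P\<close> is nondecreasing; it vanishes at \<open>z\<close>, so
      \<open>u'\<close> is nonpositive at 0 and nonnegative at 1. For \<open>lo\<close> the signs
      are reversed.\<close>
    have mono: "u' hi s * exp (P s) \<le> u' hi t * exp (P t)" if "0 \<le> s" "s \<le> t" "t \<le> 1" for s t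
    proof (rule DERIV_nonneg_imp_nondecreasing[OF \<open>s \<le> t\<close>])
      fix x assume "s \<le> x" "x \<le> t"
      hence "r x * (hi - c x) * u hi x * exp (P x) \<ge> 0"
        using r(2)[of x] xmax[of x] u_pos[OF g, of x] that by (auto simp: hi_def intro!: mult_nonneg_nonneg)
      thus "\<exists>y. ((\<lambda>x. u' hi x * exp (P x)) has_real_derivative y) (at x) \<and> 0 \<le> y"
        using uE by blast
    qed
    have "u' hi 0 \<le> 0" using mono[of 0 z] z by (simp add: mult_le_0_iff)
    moreover have "u' hi 1 \<ge> 0" using mono[of z 1] z by (simp add: zero_le_mult_iff)
    ultimately show ?thesis unfolding FG[OF g] using good_y2[OF g, of 1] by simp
  qed
  have F_lo: "F lo \<le> 0" if g: "good lo"
  proof -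
    obtain z where z: "0 < z" "z < 1" "u' lo z = 0" using rolle[OF g] by blast
    have mono: "u' lo t * exp (P t) \<le> u' lo s * exp (P s)" if "0 \<le> s" "s \<le> t" "t \<le> 1" for s t
    proof (rule DERIV_nonpos_imp_nonincreasing[OF \<open>s \<le> t\<close>])
      fix x assume "s \<le> x" "x \<le> t"
      hence "0 \<le> r x * (c x - lo) * u lo x * exp (P x)"
        using r(2)[of x] xmin[of x] u_pos[OF g, of x] that by (auto simp: lo_def intro!: mult_nonneg_nonneg)
      hence "r x * (lo - c x) * u lo x * exp (P x) \<le> 0" by (simp add: algebra_simps)
      thus "\<exists>y. ((\<lambda>x. u' lo x * exp (P x)) has_real_derivative y) (at x) \<and> y \<le> 0"
        using uE by blast
    qed
    have "u' lo 0 \<ge> 0" using mono[of 0 z] z by (simp add: zero_le_mult_iff)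
    moreover have "u' lo 1 \<le> 0" using mono[of z 1] z by (simp add: mult_le_0_iff)
    ultimately show ?thesis
      unfolding FG[OF g] using good_y2[OF g, of 1] by (intro mult_nonpos_nonneg) auto
  qed

  have cF: "continuous_on S F" for S
  proof -
    have at1: "continuous_on S (f 1)" if "continuous_on UNIV (\<lambda>(x, l). f x l)"
      for f :: "real \<Rightarrow> real \<Rightarrow> real"
      using continuous_on_compose2[OF that, of S "\<lambda>l. (1, l)"]
      by (simp add: continuous_on_Pair)
    thus ?thesis unfolding F_def W_def by (intro continuous_intros at1 cy1 cy2)
  qed

  have "\<exists>l. F l = 0 \<and> good l"
  proof (cases "\<forall>l\<in>{lo..hi}. good l")
    case True
    have "\<exists>l\<ge>lo. l \<le> hi \<and> F l = 0"
      by (rule IVT') (use True F_lo F_hi lohi cF in auto)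
    thus ?thesis using True by auto
  next
    case False
    \<comment> \<open>Compactness supplies the largest bad \<open>l\<close>. Every parameter above
      it is good, so a zero of \<open>F\<close> found strictly above it has a positive
      solution.\<close>
    define Bad where "Bad = {xl \<in> {0..1} \<times> {lo..hi}. h xl \<le> 0}"
    have "compact Bad"
    proof -
      have "closed Bad" unfolding Bad_def
        by (intro continuous_closed_preimage_constant continuous_on_closed_Collect_le closed_Times) (auto intro: ch)
      moreover have "bounded Bad"
        by (rule bounded_subset[of "{0..1} \<times> {lo..hi}"]) (auto simp: Bad_def intro: bounded_Times)
      ultimately show ?thesis by (simp add: compact_eq_bounded_closed)
    qed
    hence "compact (snd ` Bad)" by (intro compact_continuous_image continuous_intros)
    moreover have "snd ` Bad \<noteq> {}"
      using False by (force simp: Bad_def good_def not_less)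
    ultimately obtain l where l: "l \<in> snd ` Bad" "\<And>l'. l' \<in> snd ` Bad \<Longrightarrow> l' \<le> l"
      using compact_attains_sup by metis
    obtain x where x: "x \<in> {0..1}" "h (x, l) \<le> 0" "l \<in> {lo..hi}"
      using l(1) by (auto simp: Bad_def)
    have good_l: "good l'" if "l' > l" for l'
    proof (cases "l' \<le> hi")
      case True
      show ?thesis
      proof (rule ccontr)
        assume "\<not> good l'"
        then obtain x' where "x' \<in> {0..1}" "h (x', l') \<le> 0" by (auto simp: good_def not_less)
        hence "(x', l') \<in> Bad" using True that x by (auto simp: Bad_def)
        hence "l' \<le> l" using l(2) by force
        thus False using that by simp
      qed
    qed (simp add: good_above)
    have "l < hi" using x good_above[of l] by (force simp: good_def not_less)
    have nonneg: "h (t, l) \<ge> 0" if "t \<in> {0..1}" for t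
    proof (rule tendsto_lowerbound)
      show "((\<lambda>l'. h (t, l')) \<longlongrightarrow> h (t, l)) (at_right l)"
        using h_cont2 by (auto simp: isCont_def filterlim_at_split)
      show "eventually (\<lambda>l'. 0 \<le> h (t, l')) (at_right l)"
        using good_l that by (auto simp: good_def eventually_at_right_less less_imp_le
            intro!: eventually_mono[OF eventually_at_right_less])
    qed simp
    have hx: "h (x, l) = 0" using nonneg x by force
    hence y2x: "y2 x l = 0" by (simp add: y2h)
    have "x > 0" using hx h0[of l] x by (cases "x = 0") auto
    have y2'x: "y2' x l \<noteq> 0" using Wpos[of x l] y2x by (auto simp: W_def)
    \<comment> \<open>An interior zero of the nonnegative \<open>y2\<close> would be a minimum,
      hence a common zero of \<open>y2\<close> and \<open>y2'\<close>, which the Wronskian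
      forbids.\<close>
    have "x = 1"
    proof (rule ccontr)
      assume "x \<noteq> 1"
      hence "0 < min x (1 - x)" using x \<open>x > 0\<close> by auto
      moreover have "y2 x l \<le> y2 y l" if "\<bar>x - y\<bar> < min x (1 - x)" for y
        using that nonneg[of y] y2x by (auto simp: y2h[of y] abs_less_iff intro!: mult_nonneg_nonneg)
      ultimately have "y2' x l = 0" using DERIV_local_min[OF y2[where x = x]] by blast
      thus False using y2'x by simp
    qed
    have "y2' 1 l < 0"
    proof (rule ccontr)
      assume "\<not> y2' 1 l < 0"
      hence "y2' 1 l > 0" using y2'x \<open>x = 1\<close> by simp
      then obtain d where d: "d > 0" "\<And>h. 0 < h \<Longrightarrow> h < d \<Longrightarrow> y2 (1 - h) l < y2 1 l"
        using has_real_derivative_pos_inc_left[OF y2[of l 1]] by auto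
      define k where "k = min (d/2) (1/2)"
      have "y2 (1 - k) l < 0" using d y2x \<open>x = 1\<close> by (auto simp: k_def min_def)
      moreover have "y2 (1 - k) l \<ge> 0"
        using nonneg[of "1 - k"] d(1) by (auto simp: y2h k_def)
      ultimately show False by simp
    qed
    moreover have "y1 1 l < 0"
      using Wpos[of 1 l] y2x \<open>x = 1\<close> \<open>y2' 1 l < 0\<close> by (simp add: W_def zero_less_mult_iff)
    ultimately have "F l < 0" using Wpos[of 1 l] by (simp add: F_def)
    have "\<exists>l'\<ge>l. l' \<le> hi \<and> F l' = 0"
      by (rule IVT') (use \<open>F l < 0\<close> F_hi \<open>l < hi\<close> cF in auto)
    then obtain l' where "l \<le> l'" "F l' = 0" by blast
    thus ?thesis using good_l[of l'] \<open>F l < 0\<close> by (cases "l' = l") auto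
  qed
  then obtain l where l: "F l = 0" "good l" by blast
  have u'1: "u' l 1 = u' l 0"
    using l FG[OF l(2)] good_y2[OF l(2), of 1] by simp
  \<comment> \<open>The translate by one period solves the same equation with the same initial data.
    The Wronskians of the difference with \<open>y1\<close> and \<open>y2\<close> vanish, and these
    two being independent, so does the difference.\<close>
  define w where "w x = u l (x + 1) - u l x" for x
  define w' where "w' x = u' l (x + 1) - u' l x" for x
  have per: "\<beta> (x + 1) = \<beta> x" "r (x + 1) = r x" "c (x + 1) = c x" for x
    using \<beta> r c by (auto simp: C0_circle_def)
  have w: "(w has_real_derivative w' x) (at x)" for x
    unfolding w_def w'_def using u[of l "x + 1"] u[of l x]
    by (intro DERIV_diff) (simp_all add: DERIV_shift)
  have w': "(w' has_real_derivative r x * (l - c x) * w x - \<beta> x * w' x) (at x)" for x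
  proof -
    have "(w' has_real_derivative (r x * (l - c x) * u l (x + 1) - \<beta> x * u' l (x + 1))
        - (r x * (l - c x) * u l x - \<beta> x * u' l x)) (at x)"
      unfolding w'_def using u'[of l "x + 1"] u'[of l x]
      by (intro DERIV_diff) (simp_all add: DERIV_shift per)
    thus ?thesis by (simp add: w_def w'_def algebra_simps)
  qed
  have w0: "w 0 = 0" "w' 0 = 0" using u0 u1[OF l(2)] u'1 by (simp_all add: w_def w'_def)
  have "w x = 0" for x
  proof -
    have "w x * y2' x l - w' x * y2 x l = 0" "w x * y1' x l - w' x * y1 x l = 0"
      using fundamental_system_wronskian[OF w w' y2 y2' P, of x]
        fundamental_system_wronskian[OF w w' y1 y1' P, of x] w0 by simp_all
    hence "w x * W x l = 0" unfolding W_def by algebra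
    thus ?thesis using Wpos[of x l] by simp
  qed
  hence uper: "u l (x + 1) = u l x" for x by (simp add: w_def)
  moreover have "u l x > 0" for x
    using u_pos[OF l(2), of "frac x"] frac_in(1)[of x] periodic_frac[of "u l", OF uper] by simp
  ultimately show ?thesis using that u u' by blast
qed

lemma principal_eigenpair:
  fixes a b c :: "real \<Rightarrow> real"
  assumes a: "a \<in> C0_circle" "\<And>x. a x > 0" and b: "b \<in> C0_circle" and c: "c \<in> C0_circle"
    and "\<epsilon> > 0"
  obtains u where "u \<in> C2_circle" "\<And>x. u x > 0"
    "\<And>x. gen a b \<epsilon> u x + c x * u x = principal_eigenvalue a b \<epsilon> c * u x"
proof -
  define r where "r x = 1 / (\<epsilon> * a x)" for x
  have nz: "\<epsilon> * a x \<noteq> 0" for x using a(2)[of x] \<open>\<epsilon> > 0\<close> by simp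
  have r: "r \<in> C0_circle"
    using a nz unfolding r_def C0_circle_def by (auto intro!: continuous_intros)
  have \<beta>: "(\<lambda>x. b x * r x) \<in> C0_circle"
    using b r unfolding C0_circle_def by (auto intro!: continuous_intros)
  have rpos: "r x > 0" for x using a(2)[of x] \<open>\<epsilon> > 0\<close> by (simp add: r_def)
  obtain l u u' where u: "\<And>x. u x > 0" "\<And>x. u (x + 1) = u x"
    "\<And>x. (u has_real_derivative u' x) (at x)"
    "\<And>x. (u' has_real_derivative r x * (l - c x) * u x - b x * r x * u' x) (at x)"
    by (rule positive_periodic_solution[OF \<beta> r rpos c]) (rule that)
  have cont: "continuous_on UNIV (\<lambda>x. r x * (l - c x) * u x - b x * r x * u' x)"
  proof -
    have "continuous_on UNIV u" "continuous_on UNIV u'"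
      using u(3,4) by (meson DERIV_isCont continuous_at_imp_continuous_on)+
    thus ?thesis using r b c by (auto simp: C0_circle_def intro!: continuous_intros)
  qed
  note C2 = C2_circle_real_I[OF u(2,3,4) cont]
  have eig: "gen a b \<epsilon> u x + c x * u x = l * u x" for x
    unfolding gen_def C2(3) unfolding C2(2) using nz[of x] by (simp add: r_def field_simps)
  moreover have "principal_eigenvalue a b \<epsilon> c = l"
    using principal_eigenvalue_eqI[OF C2(1) u(1) eig] assms by (auto simp: C0_circle_def)
  ultimately show ?thesis using that C2(1) u(1) by blast
qed

section \<open>Gamma-convergence\<close>

lemma gen_ratio_C0:
  fixes u :: "real \<Rightarrow> real"
  assumes "a \<in> C0_circle" "b \<in> C0_circle" "u \<in> C2_circle" "\<And>x. u x > 0"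
  shows "(\<lambda>x. gen a b \<epsilon> u x / u x) \<in> C0_circle"
proof -
  have "u x \<noteq> 0" for x using assms(4)[of x] by simp
  thus ?thesis
    using assms(1,2) C2_circle_C0[OF assms(3)] C2_circle_D_C0[OF assms(3)] C2_circle_DD_C0[OF assms(3)]
    unfolding gen_def by (auto simp: C0_circle_def intro!: continuous_intros)
qed

lemma P_circle_integrable:
  fixes f :: "real \<Rightarrow> real"
  assumes "\<mu> \<in> P_circle" "f \<in> C0_circle"
  shows "integrable \<mu> f"
proof -
  interpret prob_space \<mu> using assms by (simp add: P_circle_def)
  obtain B where B: "\<And>x. norm (f x) \<le> B" using C0_circle_bounded[OF assms(2)] by blast
  have "f \<in> borel_measurable borel"
    using assms(2) by (intro borel_measurable_continuous_onI) (simp add: C0_circle_def)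
  hence "f \<in> borel_measurable (restrict_space borel {0..<1})"
    by (rule measurable_restrict_space1)
  hence "f \<in> borel_measurable \<mu>"
    using assms(1) by (simp add: P_circle_def cong: measurable_cong_sets)
  thus ?thesis using B by (intro integrable_const_bound[where B = B]) auto
qed

lemma P_circle_integral_bounds:
  fixes f :: "real \<Rightarrow> real"
  assumes "\<mu> \<in> P_circle" "f \<in> C0_circle"
  shows "(\<And>x. f x \<le> k) \<Longrightarrow> (\<integral>x. f x \<partial>\<mu>) \<le> k" "(\<And>x. k \<le> f x) \<Longrightarrow> k \<le> (\<integral>x. f x \<partial>\<mu>)"
proof -
  interpret prob_space \<mu> using assms by (simp add: P_circle_def)
  show "(\<And>x. f x \<le> k) \<Longrightarrow> (\<integral>x. f x \<partial>\<mu>) \<le> k"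
    by (rule integral_le_const[OF P_circle_integrable[OF assms]]) simp
  show "(\<And>x. k \<le> f x) \<Longrightarrow> k \<le> (\<integral>x. f x \<partial>\<mu>)"
    by (rule integral_ge_const[OF P_circle_integrable[OF assms]]) simp
qed

text \<open>The function \<open>f\<close> does not vary with \<epsilon>, so the quadratic remainder
  is \<epsilon> times one fixed continuous periodic function.\<close>

lemma gen_exp_bound:
  fixes a f :: "real \<Rightarrow> real"
  assumes a: "a \<in> C0_circle" and f: "f \<in> C2_circle"
  obtains B where "\<And>\<epsilon> x. \<epsilon> > 0 \<Longrightarrow>
    \<bar>gen a b \<epsilon> (\<lambda>x. exp (f x)) x / exp (f x) - b x * D f x\<bar> \<le> \<epsilon> * B" "B > 0"
proof -
  have "(\<lambda>x. a x * (D (D f) x + (D f x)\<^sup>2)) \<in> C0_circle"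
    using a C2_circle_D_C0[OF f] C2_circle_DD_C0[OF f]
    by (auto simp: C0_circle_def intro!: continuous_intros)
  then obtain B where B: "B > 0" "\<And>x. norm (a x * (D (D f) x + (D f x)\<^sup>2)) \<le> B"
    using C0_circle_bounded by blast
  have "\<bar>gen a b \<epsilon> (\<lambda>x. exp (f x)) x / exp (f x) - b x * D f x\<bar> \<le> \<epsilon> * B" if "\<epsilon> > 0" for \<epsilon> x
  proof -
    have "gen a b \<epsilon> (\<lambda>x. exp (f x)) x / exp (f x) - b x * D f x
        = \<epsilon> * (a x * (D (D f) x + (D f x)\<^sup>2))"
      by (simp add: gen_exp[OF f])
    thus ?thesis using B(2)[of x] that by (simp add: abs_mult mult_left_mono)
  qed
  thus ?thesis using that B by blast
qed

section \<open>The average invariant under the flow of \<open>b\<close>\<close>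

locale circle_flow =
  fixes b :: "real \<Rightarrow> real" and Z :: real
  assumes b_C2: "b \<in> C2_circle" and b_nz: "b x \<noteq> 0"
  defines "Z \<equiv> integral {0..1} (\<lambda>x. 1 / b x)"
begin

text \<open>The average of \<open>f\<close> against the probability measure invariant under the flow of \<open>b\<close>.\<close>

definition avg :: "(real \<Rightarrow> real) \<Rightarrow> real" where
  "avg f = integral {0..1} (\<lambda>x. f x / (b x * Z))"

lemma b_C0: "b \<in> C0_circle"
  by (rule C2_circle_C0[OF b_C2])

lemma inv_b_cont: "continuous_on S (\<lambda>x. 1 / b x)"
  using b_C0 b_nz by (auto simp: C0_circle_def intro!: continuous_intros elim: continuous_on_subset)

text \<open>By the intermediate value theorem \<open>b\<close> has constant sign, which its
  reciprocal integral \<open>Z\<close> shares. The density \<open>1 / (b x * Z)\<close> is therefore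
  positive for either direction of the flow.\<close>

lemma bZ_pos: "b x * Z > 0"
proof -
  have cont: "continuous_on S b" for S
    using b_C0 by (auto simp: C0_circle_def elim: continuous_on_subset)
  have sign: "b x * b y > 0" for x y
  proof (rule ccontr)
    assume "\<not> b x * b y > 0"
    hence "b x < 0 \<and> 0 < b y \<or> b y < 0 \<and> 0 < b x"
      using b_nz[of x] b_nz[of y] by (auto simp: not_less mult_less_0_iff order.order_iff_strict)
    hence "\<exists>z. b z = 0"
    proof
      assume "b x < 0 \<and> 0 < b y"
      thus ?thesis
        using IVT'[of b x 0 y] IVT2'[of b x 0 y] cont by (metis less_imp_le linear)
    next
      assume "b y < 0 \<and> 0 < b x"
      thus ?thesis
        using IVT'[of b y 0 x] IVT2'[of b y 0 x] cont by (metis less_imp_le linear)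
    qed
    thus False using b_nz by blast
  qed
  have pos: "b x / b y > 0" for y
    using sign[of x y] by (simp add: zero_less_divide_iff zero_less_mult_iff)
  have int: "(\<lambda>y. b x * (1 / b y)) integrable_on {0..1}"
    by (intro integrable_continuous_real continuous_on_mult inv_b_cont continuous_on_const)
  have "0 \<le> integral {0..1} (\<lambda>y. b x * (1 / b y))"
    using pos by (intro integral_nonneg int) (simp add: less_imp_le)
  moreover have "integral {0..1} (\<lambda>y. b x * (1 / b y)) \<noteq> 0"
  proof
    assume "integral {0..1} (\<lambda>y. b x * (1 / b y)) = 0"
    hence "((\<lambda>y. b x * (1 / b y)) has_integral 0) {0..1}"
      using int by (metis integrable_integral)
    moreover have "continuous_on {0..1} (\<lambda>y. b x / b y)"
      using continuous_on_mult[OF continuous_on_const inv_b_cont] by simp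
    ultimately have "b x * (1 / b 0) = 0"
      using has_integral_0_cbox_imp_0[of 0 "1::real" "\<lambda>y. b x * (1 / b y)" 0] pos
      by (auto simp: less_imp_le)
    thus False using b_nz by simp
  qed
  ultimately have "0 < integral {0..1} (\<lambda>y. b x * (1 / b y))" by linarith
  thus ?thesis by (simp only: Z_def integral_mult_right)
qed

lemma bZ_nz: "b x * Z \<noteq> 0"
  using bZ_pos[of x] by (metis less_irrefl)

lemma avg_integrable:
  assumes "f \<in> C0_circle"
  shows "(\<lambda>x. f x / (b x * Z)) integrable_on {0..1}"
proof -
  have "continuous_on {0..1} f" "continuous_on {0..1} b"
    using assms b_C0 by (auto simp: C0_circle_def elim: continuous_on_subset)
  thus ?thesis using bZ_nz by (intro integrable_continuous_real continuous_intros) auto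
qed

lemma avg_const: "avg (\<lambda>_. k) = k"
proof -
  have Z: "Z \<noteq> 0" using bZ_pos[of 0] by auto
  have "avg (\<lambda>_. k) = integral {0..1} (\<lambda>x. (k / Z) *\<^sub>R (1 / b x))"
    unfolding avg_def by (intro arg_cong[where f = "integral _"]) (auto simp: field_simps)
  also have "\<dots> = (k / Z) *\<^sub>R Z" unfolding integral_cmul Z_def ..
  finally show ?thesis using Z by simp
qed

lemma avg_cmult: "avg (\<lambda>x. k * f x) = k * avg f"
  by (simp add: avg_def flip: integral_mult_right)

lemma avg_diff: "f \<in> C0_circle \<Longrightarrow> g \<in> C0_circle \<Longrightarrow> avg (\<lambda>x. f x - g x) = avg f - avg g"
  unfolding avg_def diff_divide_distrib
  by (intro Henstock_Kurzweil_Integration.integral_diff avg_integrable)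

lemma avg_mono:
  assumes "f \<in> C0_circle" "g \<in> C0_circle" "\<And>x. f x \<le> g x"
  shows "avg f \<le> avg g"
  unfolding avg_def using assms
  by (intro integral_le avg_integrable divide_right_mono less_imp_le[OF bZ_pos]) auto

lemma avg_close:
  assumes "f \<in> C0_circle" "g \<in> C0_circle" "\<And>x. \<bar>f x - g x\<bar> \<le> \<delta>"
  shows "\<bar>avg f - avg g\<bar> \<le> \<delta>"
proof -
  have d: "(\<lambda>x. f x - g x) \<in> C0_circle"
    using assms by (auto simp: C0_circle_def intro!: continuous_intros)
  have k: "(\<lambda>_. k) \<in> C0_circle" for k :: real by (simp add: C0_circle_def)
  have le: "f x - g x \<le> \<delta>" "- \<delta> \<le> f x - g x" for x
    using assms(3)[of x] by (simp_all add: abs_le_iff)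
  show ?thesis
    using avg_mono[OF d k[of \<delta>] le(1)] avg_mono[OF k[of "- \<delta>"] d le(2)]
    by (simp add: avg_const avg_diff assms(1,2) abs_le_iff)
qed

text \<open>The equation prescribes \<open>f' = (avg c - c) / b\<close>. Its integral over a period
  vanishes because \<open>avg\<close> is weighted by \<open>1 / b\<close>, so the primitive closes
  up on the circle.\<close>

lemma cohomological_equation:
  assumes c: "c \<in> C0_circle" "c' \<in> C0_circle" "\<And>x. (c has_real_derivative c' x) (at x)"
  obtains f where "f \<in> C2_circle" "\<And>x. b x * D f x + c x = avg c"
proof -
  define g where "g x = (avg c - c x) / b x" for x
  define g' where "g' x = (- c' x * b x - (avg c - c x) * D b x) / (b x * b x)" for x
  have g': "(g has_real_derivative g' x) (at x)" for x
    unfolding g_def g'_def using b_nz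
    by (auto intro!: derivative_eq_intros c C2_circle_DERIV(1)[OF b_C2])
  have "continuous_on UNIV g"
    using g' by (meson DERIV_isCont continuous_at_imp_continuous_on)
  then obtain f where f: "\<And>x. (f has_real_derivative g x) (at x)"
    using continuous_antiderivative_real by blast
  have "(g has_integral f 1 - f 0) {0..1}"
    by (rule has_integral_DERIV[OF f]) simp
  moreover have "integral {0..1} g = 0"
  proof -
    have Z: "Z \<noteq> 0" using bZ_pos[of 0] by auto
    have "integral {0..1} g = integral {0..1} (\<lambda>x. Z *\<^sub>R ((avg c - c x) / (b x * Z)))"
      using Z by (intro arg_cong[where f = "integral _"]) (auto simp: g_def)
    also have "\<dots> = Z * avg (\<lambda>x. avg c - c x)"
      unfolding integral_cmul avg_def by simp
    also have "avg (\<lambda>x. avg c - c x) = 0"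
      using avg_diff[of "\<lambda>_. avg c" c] c by (simp add: avg_const C0_circle_def)
    finally show ?thesis by simp
  qed
  ultimately have f01: "f 1 = f 0" by (simp add: integral_unique)
  have gper: "g (x + 1) = g x" for x
    using c b_C0 by (simp add: g_def C0_circle_def)
  have "((\<lambda>x. f (x + 1) - f x) has_real_derivative g (x + 1) - g x) (at x)" for x
    using f[of "x + 1"] f[of x] by (intro DERIV_diff) (simp_all add: DERIV_shift)
  hence "((\<lambda>x. f (x + 1) - f x) has_real_derivative 0) (at x)" for x
    by (simp add: gper)
  hence "f (x + 1) - f x = f (0 + 1) - f 0" for x
    using DERIV_isconst_all[of "\<lambda>x. f (x + 1) - f x" x 0] by blast
  hence per: "f (x + 1) = f x" for x using f01 by simp
  have cont: "continuous_on UNIV g'"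
    using c C2_circle_D_C0[OF b_C2] b_C0 b_nz unfolding g'_def
    by (auto simp: C0_circle_def intro!: continuous_intros)
  note C2 = C2_circle_real_I[OF per f g' cont]
  show ?thesis
  proof (rule that[OF C2(1)])
    fix x show "b x * D f x + c x = avg c"
      unfolding C2(2) using b_nz[of x] by (simp add: g_def)
  qed
qed

text \<open>What matters is that \<open>M\<close> does not depend on \<open>u\<close>. At order zero
  in \<epsilon>, the drift against the invariant density is the total derivative
  \<open>w' / Z\<close> of a periodic function.\<close>

lemma avg_gen_ratio_ge:
  fixes a :: "real \<Rightarrow> real"
  assumes a: "a \<in> C2_circle" "\<And>x. a x > 0"
  obtains M where "\<And>\<epsilon> u. \<epsilon> > 0 \<Longrightarrow> u \<in> C2_circle \<Longrightarrow> (\<And>x. u x > 0) \<Longrightarrow>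
    - avg (\<lambda>x. gen a b \<epsilon> u x / u x) \<le> \<epsilon> * M"
proof -
  define \<rho> where "\<rho> x = a x / (b x * Z)" for x
  define \<rho>' where "\<rho>' x = (D a x * (b x * Z) - a x * (D b x * Z)) / ((b x * Z) * (b x * Z))" for x
  note bZ = bZ_nz
  have \<rho>_pos: "\<rho> x > 0" for x using a bZ_pos by (simp add: \<rho>_def)
  have \<rho>: "(\<rho> has_real_derivative \<rho>' x) (at x)" for x
    unfolding \<rho>_def \<rho>'_def using bZ
    by (auto intro!: derivative_eq_intros C2_circle_DERIV(1)[OF a(1)] C2_circle_DERIV(1)[OF b_C2])
  have \<rho>'_cont: "continuous_on S \<rho>'" for S
    unfolding \<rho>'_def
    using C2_circle_C0[OF a(1)] C2_circle_D_C0[OF a(1)] b_C0 C2_circle_D_C0[OF b_C2] bZ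
    by (auto simp: C0_circle_def intro!: continuous_intros elim: continuous_on_subset)
  have \<rho>_cont: "continuous_on S \<rho>" for S
    using \<rho> by (meson DERIV_continuous_on has_field_derivative_at_within)
  have M_int: "(\<lambda>x. (\<rho>' x)\<^sup>2 / (4 * \<rho> x)) integrable_on {0..1}"
    using \<rho>_pos by (intro integrable_continuous_real continuous_intros \<rho>_cont \<rho>'_cont)
      (auto simp: less_imp_neq[symmetric])
  define M where "M = integral {0..1} (\<lambda>x. (\<rho>' x)\<^sup>2 / (4 * \<rho> x))"
  show ?thesis
  proof (rule that[of M])
    fix \<epsilon> :: real and u :: "real \<Rightarrow> real"
    assume "\<epsilon> > 0" and u: "u \<in> C2_circle" "\<And>x. u x > 0"
    define w where "w x = ln (u x)" for x
    note lnu = C2_circle_ln[OF u, folded w_def]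
    have w: "w \<in> C2_circle" using lnu(1) by (simp add: w_def[abs_def])
    have u_eq: "u = (\<lambda>x. exp (w x))" using u(2) by (simp add: w_def)
    have per: "w (x + 1) = w x" "D w (x + 1) = D w x" "\<rho> (x + 1) = \<rho> x" for x
      using C2_circle_C0[OF w] C2_circle_D_C0[OF w] C2_circle_C0[OF a(1)] b_C0
      by (simp_all add: C0_circle_def \<rho>_def)
    \<comment> \<open>Integration by parts in the form of a periodic primitive: its derivative has
      integral 0 and cancels the drift and the second derivative of \<open>w\<close>.\<close>
    define G where "G x = \<epsilon> * \<rho> x * D w x + w x / Z" for x
    have G: "(G has_real_derivative \<epsilon> * (\<rho>' x * D w x + \<rho> x * D (D w) x) + D w x / Z) (at x)" for x
      unfolding G_def
      using bZ_nz[of x]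
      by (auto intro!: derivative_eq_intros \<rho> C2_circle_DERIV[OF w] simp: algebra_simps)
    have "((\<lambda>x. \<epsilon> * (\<rho>' x * D w x + \<rho> x * D (D w) x) + D w x / Z) has_integral G 1 - G 0) {0..1}"
      by (rule has_integral_DERIV[OF G]) simp
    moreover have "G 1 = G 0" using per[of 0] by (simp add: G_def)
    ultimately have i1: "((\<lambda>x. \<epsilon> * (\<rho>' x * D w x + \<rho> x * D (D w) x) + D w x / Z) has_integral 0) {0..1}"
      by simp
    note gen0 = gen_ratio_C0[OF C2_circle_C0[OF a(1)] b_C0 u, of \<epsilon>]
    have ub: "((\<lambda>x. \<epsilon> * ((\<rho>' x)\<^sup>2 / (4 * \<rho> x))) has_integral \<epsilon> * M) {0..1}"
      unfolding M_def by (intro has_integral_mult_right integrable_integral M_int)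
    have lb: "((\<lambda>x. (\<epsilon> * (\<rho>' x * D w x + \<rho> x * D (D w) x) + D w x / Z)
        - gen a b \<epsilon> u x / u x / (b x * Z)) has_integral 0 - avg (\<lambda>x. gen a b \<epsilon> u x / u x)) {0..1}"
      unfolding avg_def by (intro has_integral_diff i1 integrable_integral avg_integrable gen0)
    have le: "(\<epsilon> * (\<rho>' x * D w x + \<rho> x * D (D w) x) + D w x / Z)
        - gen a b \<epsilon> u x / u x / (b x * Z) \<le> \<epsilon> * ((\<rho>' x)\<^sup>2 / (4 * \<rho> x))" for x
    proof -
      have "gen a b \<epsilon> u x / u x / (b x * Z) = \<epsilon> * \<rho> x * (D (D w) x + (D w x)\<^sup>2) + D w x / Z"
        unfolding u_eq gen_exp[OF w] using bZ[of x] b_nz[of x] by (simp add: \<rho>_def field_simps)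
      hence "(\<epsilon> * (\<rho>' x * D w x + \<rho> x * D (D w) x) + D w x / Z) - gen a b \<epsilon> u x / u x / (b x * Z)
          = \<epsilon> * (\<rho>' x * D w x - \<rho> x * (D w x)\<^sup>2)" by (simp add: algebra_simps)
      \<comment> \<open>Completing the square in \<open>D w\<close> removes every trace of
        \<open>u\<close>.\<close>
      also have "\<rho>' x * D w x - \<rho> x * (D w x)\<^sup>2 \<le> (\<rho>' x)\<^sup>2 / (4 * \<rho> x)"
      proof -
        have "(\<rho>' x)\<^sup>2 / (4 * \<rho> x) - (\<rho>' x * D w x - \<rho> x * (D w x)\<^sup>2)
            = (\<rho>' x - 2 * \<rho> x * D w x)\<^sup>2 / (4 * \<rho> x)"
          using \<rho>_pos[of x] by (simp add: field_simps power2_eq_square)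
        also have "\<dots> \<ge> 0" using \<rho>_pos[of x] by simp
        finally show ?thesis by simp
      qed
      finally show ?thesis using \<open>\<epsilon> > 0\<close> by simp
    qed
    show "- avg (\<lambda>x. gen a b \<epsilon> u x / u x) \<le> \<epsilon> * M"
      using has_integral_le[OF lb ub le] by simp
  qed
qed

text \<open>The cohomological equation makes the quotient of \<open>exp f\<close> equal to
  \<open>avg c1 - c1\<close> up to order \<epsilon>, whereas that of the eigenfunction is the
  eigenvalue minus \<open>c\<close>. Comparing the two in both orders encloses the
  eigenvalue.\<close>

lemma Lambda_eq_avg:
  fixes a :: "real \<Rightarrow> real"
  assumes a: "a \<in> C2_circle" "\<And>x. a x > 0" and c: "c \<in> C0_circle"
  shows "Lambda a b c = avg c"
proof -
  have "((\<lambda>\<epsilon>. principal_eigenvalue a b \<epsilon> c) \<longlongrightarrow> avg c) (at_right 0)"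
  proof (rule tendstoI)
    fix e :: real assume "e > 0"
    \<comment> \<open>Three errors below or equal to \<open>e / 4\<close> add up: the pointwise
      change of \<open>c\<close>, the change of its average, and
      \<open>\<epsilon> * B\<close>.\<close>
    obtain c1 c1' where c1: "c1 \<in> C0_circle" "c1' \<in> C0_circle"
      "\<And>x. (c1 has_real_derivative c1' x) (at x)" "\<And>x. \<bar>c1 x - c x\<bar> \<le> e / 4"
      using C0_circle_mollify[OF c, of "e / 4"] \<open>e > 0\<close> by auto
    obtain f where f: "f \<in> C2_circle" "\<And>x. b x * D f x + c1 x = avg c1"
      using cohomological_equation[OF c1(1-3)] by blast
    obtain B where B: "B > 0" "\<And>\<epsilon> x. \<epsilon> > 0 \<Longrightarrow>
        \<bar>gen a b \<epsilon> (\<lambda>x. exp (f x)) x / exp (f x) - b x * D f x\<bar> \<le> \<epsilon> * B"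
      using gen_exp_bound[OF C2_circle_C0[OF a(1)] f(1)] by metis
    have close: "\<bar>avg c1 - avg c\<bar> \<le> e / 4" by (rule avg_close[OF c1(1) c c1(4)])
    have "dist (principal_eigenvalue a b \<epsilon> c) (avg c) < e" if \<epsilon>: "0 < \<epsilon>" "\<epsilon> < e / (4 * B)" for \<epsilon>
    proof -
      let ?l = "principal_eigenvalue a b \<epsilon> c"
      obtain u where u: "u \<in> C2_circle" "\<And>x. u x > 0" "\<And>x. gen a b \<epsilon> u x + c x * u x = ?l * u x"
        using principal_eigenpair[OF C2_circle_C0[OF a(1)] a(2) b_C0 c \<epsilon>(1)] by blast
      have ratio: "gen a b \<epsilon> u x / u x = ?l - c x" for x
        using u(3)[of x] u(2)[of x] by (simp add: field_simps)
      have small: "\<epsilon> * B < e / 4" using \<epsilon> B(1) by (simp add: field_simps)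
      have v: "(\<lambda>x. exp (f x)) \<in> C2_circle" "\<And>x. exp (f x) > 0"
        using C2_circle_exp(1)[OF f(1)] by simp_all
      have a0: "\<And>x. a x \<ge> 0" using a(2) less_imp_le by blast
      obtain x where "gen a b \<epsilon> u x / u x \<le> gen a b \<epsilon> (\<lambda>x. exp (f x)) x / exp (f x)"
        using gen_ratio_le[where a = a and b = b, OF u(1,2) v less_imp_le[OF \<epsilon>(1)] a0] by blast
      hence up: "?l < avg c + e"
        using B(2)[OF \<epsilon>(1), of x] f(2)[of x] c1(4)[of x] close small unfolding ratio abs_le_iff
        by linarith
      obtain y where "gen a b \<epsilon> (\<lambda>x. exp (f x)) y / exp (f y) \<le> gen a b \<epsilon> u y / u y"
        using gen_ratio_le[where a = a and b = b, OF v u(1,2) less_imp_le[OF \<epsilon>(1)] a0] by blast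
      hence "?l > avg c - e"
        using B(2)[OF \<epsilon>(1), of y] f(2)[of y] c1(4)[of y] close small unfolding ratio abs_le_iff
        by linarith
      thus ?thesis using up by (simp add: dist_real_def abs_less_iff)
    qed
    moreover have "e / (4 * B) > 0" using \<open>e > 0\<close> B(1) by simp
    ultimately show "eventually (\<lambda>\<epsilon>. dist (principal_eigenvalue a b \<epsilon> c) (avg c) < e) (at_right 0)"
      by (intro eventually_at_rightI[of 0 "e / (4 * B)"]) auto
  qed
  thus ?thesis unfolding Lambda_def by (intro tendsto_Lim) auto
qed

text \<open>Equality with the invariant probability measure, phrased through continuous test
  functions, as these are all that the functionals see.\<close>

definition invariant :: "real measure \<Rightarrow> bool" where
  "invariant \<mu> \<longleftrightarrow> (\<forall>f\<in>C0_circle. (\<integral>x. f x \<partial>\<mu>) = avg f)"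

lemma J_fun_invariant:
  fixes a :: "real \<Rightarrow> real"
  assumes a: "a \<in> C2_circle" "\<And>x. a x > 0" and "invariant \<mu>"
  shows "J_fun a b \<mu> = 0"
proof -
  have "J_fun a b \<mu> = (SUP c \<in> (C0_circle :: (real \<Rightarrow> real) set). 0)"
    unfolding J_fun_def using assms by (intro SUP_cong) (auto simp: Lambda_eq_avg invariant_def)
  moreover have "(\<lambda>_. 0) \<in> (C0_circle :: (real \<Rightarrow> real) set)" by (simp add: C0_circle_def)
  ultimately show ?thesis by (metis SUP_const empty_iff)
qed

text \<open>\<open>Lambda\<close> is homogeneous, so a multiple of a separating test function
  attains any prescribed real value; the factor \<open>t\<close> also absorbs the sign of the
  gap.\<close>

lemma J_fun_not_invariant:
  fixes a :: "real \<Rightarrow> real"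
  assumes a: "a \<in> C2_circle" "\<And>x. a x > 0" and "\<not> invariant \<mu>"
  shows "J_fun a b \<mu> = \<infinity>"
proof (rule ereal_top)
  fix n :: real
  obtain c where c: "c \<in> C0_circle" "(\<integral>x. c x \<partial>\<mu>) \<noteq> avg c"
    using assms(3) by (auto simp: invariant_def)
  define t where "t = n / ((\<integral>x. c x \<partial>\<mu>) - avg c)"
  have tc: "(\<lambda>x. t * c x) \<in> C0_circle"
    using c(1) by (auto simp: C0_circle_def intro!: continuous_intros)
  have "(\<integral>x. t * c x \<partial>\<mu>) - Lambda a b (\<lambda>x. t * c x) = t * ((\<integral>x. c x \<partial>\<mu>) - avg c)"
    by (simp add: Lambda_eq_avg[OF a tc] avg_cmult algebra_simps)
  also have "\<dots> = n" using c(2) by (simp add: t_def)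
  finally show "ereal n \<le> J_fun a b \<mu>"
    unfolding J_fun_def using tc by (intro SUP_upper2[of "\<lambda>x. t * c x"]) auto
qed

section \<open>Lower and upper bounds for the functionals as \<epsilon> tends to 0\<close>

lemma I_fun_ge:
  assumes "u \<in> C2_circle" "\<And>x. u x > 0"
  shows "ereal (- (\<integral>x. gen a b \<epsilon> u x / u x \<partial>\<mu>)) \<le> I_fun a b \<epsilon> \<mu>"
  unfolding I_fun_def by (rule SUP_upper) (use assms in auto)

lemma I_fun_nonneg: "0 \<le> I_fun a b \<epsilon> \<mu>"
proof -
  have z: "(\<lambda>x. 0::real) \<in> C2_circle" "D (\<lambda>x. 0::real) = (\<lambda>_. 0)" "D (D (\<lambda>x. 0::real)) = (\<lambda>_. 0)"
    by (rule C2_circle_real_I[of "\<lambda>_. 0" "\<lambda>_. 0" "\<lambda>_. 0"]; simp)+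
  have "gen a b \<epsilon> (\<lambda>x. exp 0 :: real) x / exp 0 = 0" for x
    using gen_exp[OF z(1), of a b \<epsilon> x] unfolding z by simp
  thus ?thesis
    using I_fun_ge[OF C2_circle_exp(1)[OF z(1)], where a = a and \<epsilon> = \<epsilon> and \<mu> = \<mu>] by (simp add: zero_ereal_def)
qed

text \<open>For \<open>u = exp (t f)\<close> the negative integral is \<open>t\<close> times the gap
  between the integral and the average of \<open>c1\<close>, up to order \<epsilon>. It involves the
  measure only through the continuous \<open>c1\<close>, so weak convergence passes to the
  limit.\<close>

lemma gamma_liminf:
  fixes a :: "real \<Rightarrow> real"
  assumes a: "a \<in> C2_circle" "\<And>x. a x > 0" and \<mu>: "\<mu> \<in> P_circle"
    and m: "\<And>\<epsilon>. \<epsilon> > 0 \<Longrightarrow> m \<epsilon> \<in> P_circle" and lim: "weakly_converges m \<mu> (at_right 0)"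
  shows "J_fun a b \<mu> \<le> Liminf (at_right 0) (\<lambda>\<epsilon>. I_fun a b \<epsilon> (m \<epsilon>))"
proof (cases "invariant \<mu>")
  case True
  show ?thesis unfolding J_fun_invariant[OF a True]
    by (intro Liminf_bounded always_eventually allI I_fun_nonneg)
next
  case False
  then obtain c where c: "c \<in> C0_circle" "(\<integral>x. c x \<partial>\<mu>) \<noteq> avg c"
    by (auto simp: invariant_def)
  \<comment> \<open>Mollification moves the integral and the average by at most a third of the gap
    each, so a gap remains.\<close>
  define \<delta> where "\<delta> = \<bar>(\<integral>x. c x \<partial>\<mu>) - avg c\<bar> / 3"
  have "\<delta> > 0" using c(2) by (simp add: \<delta>_def)
  obtain c1 c1' where c1: "c1 \<in> C0_circle" "c1' \<in> C0_circle"
    "\<And>x. (c1 has_real_derivative c1' x) (at x)" "\<And>x. \<bar>c1 x - c x\<bar> \<le> \<delta>"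
    using C0_circle_mollify[OF c(1) \<open>\<delta> > 0\<close>] by blast
  have ne: "(\<integral>x. c1 x \<partial>\<mu>) \<noteq> avg c1"
  proof -
    have diff: "(\<lambda>x. c1 x - c x) \<in> C0_circle"
      using c c1 by (auto simp: C0_circle_def intro!: continuous_intros)
    have b: "c1 x - c x \<le> \<delta>" "- \<delta> \<le> c1 x - c x" for x
      using c1(4)[of x] by (simp_all add: abs_le_iff)
    have "(\<integral>x. c1 x - c x \<partial>\<mu>) = (\<integral>x. c1 x \<partial>\<mu>) - (\<integral>x. c x \<partial>\<mu>)"
      by (intro Bochner_Integration.integral_diff P_circle_integrable \<mu> c c1)
    hence "\<bar>(\<integral>x. c1 x \<partial>\<mu>) - (\<integral>x. c x \<partial>\<mu>)\<bar> \<le> \<delta>"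
      using P_circle_integral_bounds(1)[OF \<mu> diff b(1)] P_circle_integral_bounds(2)[OF \<mu> diff b(2)]
      by (simp add: abs_le_iff)
    moreover have "\<bar>avg c1 - avg c\<bar> \<le> \<delta>" by (rule avg_close[OF c1(1) c(1) c1(4)])
    moreover have "\<bar>(\<integral>x. c x \<partial>\<mu>) - avg c\<bar> = 3 * \<delta>" by (simp add: \<delta>_def)
    ultimately show ?thesis using \<open>\<delta> > 0\<close> by (intro notI) linarith
  qed
  obtain f where f: "f \<in> C2_circle" "\<And>x. b x * D f x + c1 x = avg c1"
    using cohomological_equation[OF c1(1-3)] by blast
  have "Liminf (at_right 0) (\<lambda>\<epsilon>. I_fun a b \<epsilon> (m \<epsilon>)) = \<infinity>"
  proof (rule ereal_top)
    fix n :: real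
    \<comment> \<open>Chosen so that the lower bound \<open>g\<close> tends to \<open>n\<close>. The
      constant \<open>B\<close> depends on \<open>t\<close>, but \<open>t\<close> is fixed before
      \<epsilon> tends to 0.\<close>
    define t where "t = n / ((\<integral>x. c1 x \<partial>\<mu>) - avg c1)"
    note tf = C2_circle_cmult[OF f(1), of t]
    obtain B where B: "B > 0" "\<And>\<epsilon> x. \<epsilon> > 0 \<Longrightarrow>
        \<bar>gen a b \<epsilon> (\<lambda>x. exp (t * f x)) x / exp (t * f x) - b x * D (\<lambda>x. t * f x) x\<bar> \<le> \<epsilon> * B"
      using gen_exp_bound[OF C2_circle_C0[OF a(1)] tf(1)] by metis
    define g where "g \<epsilon> = t * ((\<integral>x. c1 x \<partial>(m \<epsilon>)) - avg c1) - \<epsilon> * B" for \<epsilon>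
    have "((\<lambda>\<epsilon>. \<integral>x. c1 x \<partial>(m \<epsilon>)) \<longlongrightarrow> (\<integral>x. c1 x \<partial>\<mu>)) (at_right 0)"
      using lim c1(1) by (simp add: weakly_converges_def)
    hence "(g \<longlongrightarrow> t * ((\<integral>x. c1 x \<partial>\<mu>) - avg c1) - 0 * B) (at_right 0)"
      unfolding g_def by (intro tendsto_intros)
    moreover have "t * ((\<integral>x. c1 x \<partial>\<mu>) - avg c1) = n" using ne by (simp add: t_def)
    ultimately have "((\<lambda>\<epsilon>. ereal (g \<epsilon>)) \<longlongrightarrow> ereal n) (at_right 0)" by simp
    hence "ereal n = Liminf (at_right 0) (\<lambda>\<epsilon>. ereal (g \<epsilon>))"
      by (intro lim_imp_Liminf[symmetric]) auto
    also have "\<dots> \<le> Liminf (at_right 0) (\<lambda>\<epsilon>. I_fun a b \<epsilon> (m \<epsilon>))"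
    proof (rule Liminf_mono)
      have "ereal (g \<epsilon>) \<le> I_fun a b \<epsilon> (m \<epsilon>)" if "\<epsilon> > 0" for \<epsilon>
      proof -
        note me = m[OF that]
        interpret prob_space "m \<epsilon>" using me by (simp add: P_circle_def)
        define R where "R x = gen a b \<epsilon> (\<lambda>x. exp (t * f x)) x / exp (t * f x)" for x
        have R: "R \<in> C0_circle"
          unfolding R_def
          by (intro gen_ratio_C0 C2_circle_C0[OF a(1)] b_C0 C2_circle_exp(1) tf(1)) simp
        have S: "(\<lambda>x. R x + t * c1 x) \<in> C0_circle"
          using R c1(1) by (auto simp: C0_circle_def intro!: continuous_intros)
        have "R x + t * c1 x \<le> t * avg c1 + \<epsilon> * B" for x
          using B(2)[OF that, of x] arg_cong[OF f(2)[of x], of "\<lambda>z. t * z"] unfolding tf(2)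
          by (simp add: R_def abs_le_iff algebra_simps)
        hence "(\<integral>x. R x + t * c1 x \<partial>(m \<epsilon>)) \<le> t * avg c1 + \<epsilon> * B"
          by (rule P_circle_integral_bounds(1)[OF me S])
        moreover have "(\<integral>x. R x + t * c1 x \<partial>(m \<epsilon>)) = (\<integral>x. R x \<partial>(m \<epsilon>)) + t * (\<integral>x. c1 x \<partial>(m \<epsilon>))"
          using P_circle_integrable[OF me R] P_circle_integrable[OF me c1(1)] by simp
        ultimately have "g \<epsilon> \<le> - (\<integral>x. R x \<partial>(m \<epsilon>))" by (simp add: g_def algebra_simps)
        moreover have "ereal (- (\<integral>x. R x \<partial>(m \<epsilon>))) \<le> I_fun a b \<epsilon> (m \<epsilon>)"
          unfolding R_def by (intro I_fun_ge C2_circle_exp(1) tf(1)) simp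
        ultimately show ?thesis using order_trans ereal_less_eq(3) by blast
      qed
      thus "eventually (\<lambda>\<epsilon>. ereal (g \<epsilon>) \<le> I_fun a b \<epsilon> (m \<epsilon>)) (at_right 0)"
        by (auto intro: eventually_at_rightI[of 0 1])
    qed
    finally show "ereal n \<le> Liminf (at_right 0) (\<lambda>\<epsilon>. I_fun a b \<epsilon> (m \<epsilon>))" .
  qed
  thus ?thesis by simp
qed

lemma gamma_limsup_const:
  fixes a :: "real \<Rightarrow> real"
  assumes a: "a \<in> C2_circle" "\<And>x. a x > 0"
  shows "Limsup (at_right 0) (\<lambda>\<epsilon>. I_fun a b \<epsilon> \<mu>) \<le> J_fun a b \<mu>"
proof (cases "invariant \<mu>")
  case True
  obtain M where M: "\<And>\<epsilon> u. \<epsilon> > 0 \<Longrightarrow> u \<in> C2_circle \<Longrightarrow> (\<And>x. u x > 0) \<Longrightarrow>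
      - avg (\<lambda>x. gen a b \<epsilon> u x / u x) \<le> \<epsilon> * M"
    using avg_gen_ratio_ge[OF a] by blast
  have "I_fun a b \<epsilon> \<mu> \<le> ereal (\<epsilon> * M)" if "\<epsilon> > 0" for \<epsilon>
    unfolding I_fun_def
  proof (rule SUP_least)
    fix u :: "real \<Rightarrow> real" assume u: "u \<in> {u \<in> C2_circle. \<forall>x. 0 < u x}"
    hence "(\<integral>x. gen a b \<epsilon> u x / u x \<partial>\<mu>) = avg (\<lambda>x. gen a b \<epsilon> u x / u x)"
      using True gen_ratio_C0[OF C2_circle_C0[OF a(1)] b_C0] by (simp add: invariant_def)
    thus "ereal (- (\<integral>x. gen a b \<epsilon> u x / u x \<partial>\<mu>)) \<le> ereal (\<epsilon> * M)"
      using M[OF that, of u] u by simp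
  qed
  hence "Limsup (at_right 0) (\<lambda>\<epsilon>. I_fun a b \<epsilon> \<mu>) \<le> Limsup (at_right 0) (\<lambda>\<epsilon>. ereal (\<epsilon> * M))"
    by (intro Limsup_mono) (auto intro: eventually_at_rightI[of 0 1])
  also have "\<dots> = ereal (0 * M)"
  proof (rule lim_imp_Limsup)
    show "((\<lambda>\<epsilon>. ereal (\<epsilon> * M)) \<longlongrightarrow> ereal (0 * M)) (at_right 0)"
      unfolding lim_ereal by (intro tendsto_intros)
  qed simp
  finally show ?thesis by (simp add: J_fun_invariant[OF a True] zero_ereal_def)
next
  case False
  thus ?thesis by (simp add: J_fun_not_invariant[OF a])
qed

lemma gamma_converges_circle:
  fixes a :: "real \<Rightarrow> real"
  assumes a: "a \<in> C2_circle" "\<And>x. a x > 0"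
  shows "gamma_converges (I_fun a b) (J_fun a b)"
  unfolding gamma_converges_def
proof (intro ballI conjI allI impI)
  fix \<mu> and m :: "real \<Rightarrow> real measure"
  assume "\<mu> \<in> P_circle" "(\<forall>\<epsilon>>0. m \<epsilon> \<in> P_circle) \<and> weakly_converges m \<mu> (at_right 0)"
  thus "J_fun a b \<mu> \<le> Liminf (at_right 0) (\<lambda>\<epsilon>. I_fun a b \<epsilon> (m \<epsilon>))"
    using gamma_liminf[OF a] by blast
next
  fix \<mu> :: "real measure" assume "\<mu> \<in> P_circle"
  thus "\<exists>m. (\<forall>\<epsilon>>0. m \<epsilon> \<in> P_circle) \<and> weakly_converges m \<mu> (at_right 0) \<and>
      Limsup (at_right 0) (\<lambda>\<epsilon>. I_fun a b \<epsilon> (m \<epsilon>)) \<le> J_fun a b \<mu>"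
    using gamma_limsup_const[OF a] by (intro exI[of _ "\<lambda>_. \<mu>"]) (simp add: weakly_converges_def)
qed

end

theorem proposition6p4:
  fixes \<sigma> a b :: "real \<Rightarrow> real"
  assumes "\<sigma> \<in> C2_circle" and "b \<in> C2_circle"
    and "\<And>x. a x = (\<sigma> x)\<^sup>2 / 2"
    and "\<And>x. a x > 0"
    and "\<And>x. b x \<noteq> 0"
  shows "gamma_converges (I_fun a b) (J_fun a b)"
proof -
  interpret circle_flow b "integral {0..1} (\<lambda>x. 1 / b x)"
    using assms by unfold_locales auto
  have "a = (\<lambda>x. 1 / 2 * (\<sigma> x * \<sigma> x))"
    using assms(3) by (simp add: power2_eq_square fun_eq_iff)
  hence "a \<in> C2_circle"
    using C2_circle_cmult(1)[OF C2_circle_mult(1)[OF assms(1) assms(1)], of "1 / 2"] by simp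
  thus ?thesis using assms(4) by (rule gamma_converges_circle)
qed

end
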